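(* Let $p>5$ be a prime. Then $$\sum_{k=1}^{p-1}\frac{1}{k^4\binom{2k}{k}}\equiv \frac{H_{p-1}}{p^3}-\frac{7}{45}\,p\,B_{p-5}\pmod{p^2}.$$
   Context: For $n\ge 0$, $H_n=\sum_{k=1}^n \frac1k$ is the $n$th harmonic number. The Bernoulli numbers $B_n$ are defined by $\frac{x}{e^x-1}=\sum_{n=0}^{\infty}B_n\frac{x^n}{n!}$. For rational numbers $a,b$ and an integer $r\ge1$, $a\equiv b\pmod{p^r}$ means that the $p$-adic valuation of $a-b$ is at least $r$ (i.e. $(a-b)/p^r$ has denominator prime to $p$); the individual terms $a,b$ need not be $p$-integral. *)

theory Defs
  imports "HOL-Computational_Algebra.Computational_Algebra"
begin

text \<open>
  A rational-valued harmonic number: the constant \<open>harm\<close> of \<open>HOL-Analysis\<close> requires a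
  real normed field and so cannot be used at type \<^typ>\<open>rat\<close>.
\<close>
definition harmonic :: "nat \<Rightarrow> rat" where
  "harmonic n = (\<Sum>k=1..n. 1 / of_nat k)"

text \<open>
  The quotient is that of formal power series, where \<open>exp x - 1\<close> has subdegree 1;
  the convention is \<open>B\<^sub>1 = -1/2\<close>.
\<close>
definition bernoulli :: "nat \<Rightarrow> rat" where
  "bernoulli n = fact n * fps_nth (fps_X / (fps_exp 1 - 1)) n"

lemma bernoulli_generating_function:
  "Abs_fps (\<lambda>n. bernoulli n / fact n) = fps_X / (fps_exp 1 - 1)"
  by (simp add: fps_eq_iff bernoulli_def)

lemma bernoulli_generating_function_mult:
  "Abs_fps (\<lambda>n. bernoulli n / fact n) * (fps_exp 1 - 1) = fps_X"
proof -
  have nz: "fps_nth (fps_exp (1::rat) - 1) 1 \<noteq> 0"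
    by simp
  then have "subdegree (fps_exp (1::rat) - 1) \<le> 1"
    by (rule subdegree_leI)
  moreover have "fps_exp (1::rat) - 1 \<noteq> 0"
    using nz by (metis fps_zero_nth)
  ultimately have "(fps_exp (1::rat) - 1) dvd fps_X"
    by (simp add: fps_dvd_iff)
  then show ?thesis
    by (simp add: bernoulli_generating_function)
qed

text \<open>
  This is the \<open>p\<close>-adic valuation for prime \<open>p\<close> and \<open>x \<noteq> 0\<close>; it returns the junk value 0
  at \<open>x = 0\<close>, where the valuation is infinite.  Hence the separate disjunct \<open>a = b\<close> below.
\<close>
definition padic_val :: "nat \<Rightarrow> rat \<Rightarrow> int" where
  "padic_val p x =
     int (multiplicity (int p) (fst (quotient_of x))) -
     int (multiplicity (int p) (snd (quotient_of x)))"

definition padic_cong :: "nat \<Rightarrow> nat \<Rightarrow> rat \<Rightarrow> rat \<Rightarrow> bool" where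
  "padic_cong p r a b \<longleftrightarrow> a = b \<or> padic_val p (a - b) \<ge> int r"

lemma padic_val_of_fraction:
  assumes p: "prime p" and "m \<noteq> 0" "n \<noteq> 0"
  shows "padic_val p (of_int m / of_int n) =
    int (multiplicity (int p) m) - int (multiplicity (int p) n)"
proof -
  obtain a b where ab: "quotient_of (of_int m / of_int n) = (a, b)"
    by fastforce
  have b: "b > 0"
    using quotient_of_denom_pos[OF ab] .
  have eq: "(of_int m / of_int n :: rat) = of_int a / of_int b"
    using quotient_of_div[OF ab] .
  then have "(of_int (m * b) :: rat) = of_int (a * n)"
    using b assms by (simp add: field_simps)
  then have mb: "m * b = a * n"
    by (simp only: of_int_eq_iff)
  then have a: "a \<noteq> 0"
    using b assms by auto
  have P: "prime_elem (int p)"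
    using p by simp
  have "multiplicity (int p) m + multiplicity (int p) b =
        multiplicity (int p) a + multiplicity (int p) n"
    using mb a b assms
    by (metis P prime_elem_multiplicity_mult_distrib less_irrefl)
  then show ?thesis
    by (simp add: padic_val_def ab)
qed

lemma padic_cong_iff_denominator:
  assumes p: "prime p"
  shows "padic_cong p r a b \<longleftrightarrow>
    coprime (snd (quotient_of ((a - b) / of_nat p ^ r))) (int p)"
proof (cases "a = b")
  case True
  then show ?thesis
    by (simp add: padic_cong_def)
next
  case False
  obtain m n where mn: "quotient_of (a - b) = (m, n)"
    by fastforce
  obtain c d where cd: "quotient_of ((a - b) / of_nat p ^ r) = (c, d)"
    by fastforce
  have n: "n > 0" and d: "d > 0"
    using quotient_of_denom_pos mn cd by blast+
  have x: "a - b = of_int m / of_int n"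
    using quotient_of_div[OF mn] .
  have y: "(a - b) / of_nat p ^ r = of_int c / of_int d"
    using quotient_of_div[OF cd] .
  have p0: "p > 0"
    using p by (rule prime_gt_0_nat)
  have P: "prime_elem (int p)" "prime (int p)" "\<not> is_unit (int p)"
    using p prime_gt_1_nat[OF p] by simp_all
  have c0: "c \<noteq> 0"
    using y False p0 by auto
  have "a - b = of_int (c * int p ^ r) / of_int d"
    using y p0 d by (simp add: field_simps)
  then have "padic_val p (a - b) =
      int (multiplicity (int p) (c * int p ^ r)) - int (multiplicity (int p) d)"
    using padic_val_of_fraction[OF p, of "c * int p ^ r" d] c0 p0 d by simp
  also have "multiplicity (int p) (c * int p ^ r) = multiplicity (int p) c + r"
    using P c0 p0 by (simp add: prime_elem_multiplicity_mult_distrib)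
  finally have v: "padic_val p (a - b) =
      int (multiplicity (int p) c) + int r - int (multiplicity (int p) d)"
    by simp
  have cop: "coprime c d"
    using quotient_of_coprime[OF cd] .
  have "multiplicity (int p) d \<le> multiplicity (int p) c \<longleftrightarrow> \<not> int p dvd d"
  proof
    assume le: "multiplicity (int p) d \<le> multiplicity (int p) c"
    show "\<not> int p dvd d"
    proof
      assume dd: "int p dvd d"
      then have "multiplicity (int p) d > 0"
        using d P by (simp add: prime_multiplicity_gt_zero_iff)
      then have "int p dvd c"
        using le by (metis gr_zeroI not_dvd_imp_multiplicity_0 not_less_zero order_le_less_trans le_zero_eq)
      then show False
        using dd cop P coprime_common_divisor by blast
    qed
  next
    assume "\<not> int p dvd d"
    then show "multiplicity (int p) d \<le> multiplicity (int p) c"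
      by (simp add: not_dvd_imp_multiplicity_0)
  qed
  moreover have "coprime d (int p) \<longleftrightarrow> \<not> int p dvd d"
    using P by (metis coprime_commute prime_imp_coprime coprime_absorb_left)
  ultimately show ?thesis
    using False v by (auto simp: padic_cong_def cd)
qed

end

theory Submission
  imports Defs "HOL-Number_Theory.Residues"
begin

text \<open>
  Put \<open>t k = tcb k = 1 / (k\<^sup>2 C(2 k, k))\<close>, \<open>v k = \<Prod>m<k. (1 - p\<^sup>2 / m\<^sup>2)\<close>, and let \<open>e r k\<close> be the elementary
  symmetric functions of \<open>1 / m\<^sup>2\<close>, \<open>m < k\<close>.  A telescoping of Apery and Koecher type, in both
  indices of \<open>(k - 1)!\<^sup>2 (n - k)! / (n + k)!\<close>, gives a finite identity with a free parameter \<open>x\<close>.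

  At \<open>x = p\<^sup>2\<close> all of its terms but one are harmonic sums, and \<open>\<Sum>k<p. t k * v k = 0\<close> because
  \<open>2 cos (p \<pi> / 3) = 1\<close>.  This evaluates \<open>\<Sum>k<p. t k * v k / (k\<^sup>2 - p\<^sup>2)\<close> exactly, and expanding that sum
  \<open>p\<close>-adically leaves the required sum plus \<open>p * kappa\<close>, with
  \<open>kappa = \<Sum>k<p. p * t k * (1 / k ^ 4 - e 1 k / k\<^sup>2)\<close>, so \<open>kappa\<close> is only needed modulo \<open>p\<close>.

  The coefficient of \<open>x\<^sup>2\<close> in the same identity expresses \<open>4 * kappa + 3 * delta\<close>, with
  \<open>delta = \<Sum>k<p. p * t k * e 2 k\<close>, as a multiple harmonic sum modulo \<open>p\<close>, evaluated by Faulhaber's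
  formula.  Reflecting \<open>k\<close> to \<open>p - k\<close> and expanding in partial fractions turns \<open>delta\<close> into
  \<open>\<Sum>j<p. 2 cos (j \<pi> / 3) / j ^ 5\<close>, which Voronoi's congruence expresses through \<open>B\<^bsub>p-5\<^esub>\<close>.
\<close>

section \<open>Congruences in the ring of p-adically integral rationals\<close>

text \<open>For \<open>p / 2 < k < p\<close> the binomial \<open>C(2 k, k)\<close> contains exactly
  one factor \<open>p\<close>, so the terms are not \<open>p\<close>-integral. This is why the part
  with \<open>H\<close> comes from an exact identity over the rationals, and why only
  \<open>P * tcb k\<close> is ever reduced modulo \<open>p\<close>.

  Taking \<open>x = p^2\<close> serves two ends: \<open>vprod\<close> collapses to factorials that
  cancel the Apery weight, and it is a unit congruent to \<open>1\<close>, so it can be divided out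
  afterwards.

  Of the pair \<open>kappa\<close>, \<open>delta\<close>, it is \<open>delta\<close> that can be
  reached directly: \<open>esym 1 p\<close> and \<open>esym 2 p\<close> vanish modulo
  \<open>p\<close>, so reflection turns elementary symmetric functions into complete ones, and those
  have simple partial fractions in central binomials, which cancel against the reflected
  \<open>tcb\<close>.

  The constant is \<open>-7/45 = -3/5 + 4/9\<close>. Here \<open>-3/5\<close> is half of the
  \<open>-6/5\<close> found for \<open>pole_sum\<close>, and
  \<open>4/9 = (3/2 + 3 * 5/54) / 4\<close> is minus the coefficient of
  \<open>kappa\<close>.\<close>

definition padic_ints :: "nat \<Rightarrow> rat set" where
  "padic_ints p = {of_int a / of_int b | a b. \<not> int p dvd b}"

locale prime_adic =
  fixes p :: nat
  assumes prime_p: "prime p"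
begin

abbreviation Zp :: "rat set" where "Zp \<equiv> padic_ints p"
abbreviation P :: rat where "P \<equiv> of_nat p"
abbreviation pc :: "nat \<Rightarrow> rat \<Rightarrow> rat \<Rightarrow> bool" where "pc \<equiv> padic_cong p"

lemma p_gt_1: "p > 1" and p_pos: "p > 0"
  using prime_p prime_gt_1_nat prime_gt_0_nat by auto

lemma prime_int_p: "prime (int p)"
  using prime_p by simp

lemma Zp_of_int [simp]: "of_int a \<in> Zp"
  proof -
  have "\<not> int p dvd 1" using p_gt_1 by simp
  then show ?thesis unfolding padic_ints_def by (intro CollectI exI[of _ a] exI[of _ 1]) simp
qed

lemma Zp_of_nat [simp]: "of_nat n \<in> Zp"
  using Zp_of_int[of "int n"] by simp

lemma Zp_0 [simp]: "0 \<in> Zp" and Zp_1 [simp]: "1 \<in> Zp" and Zp_numeral [simp]: "numeral w \<in> Zp"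
  using Zp_of_int[of 0] Zp_of_int[of 1] Zp_of_int[of "numeral w"] by simp_all

lemma Zp_add [intro]:
  assumes "x \<in> Zp" "y \<in> Zp" shows "x + y \<in> Zp"
proof -
  obtain a b c d where "\<not> int p dvd b" "\<not> int p dvd d"
    and xy: "x = of_int a / of_int b" "y = of_int c / of_int d"
    using assms unfolding padic_ints_def by auto
  then have nd: "\<not> int p dvd b * d" and "b \<noteq> 0" "d \<noteq> 0"
    using prime_int_p by (auto simp: prime_dvd_mult_iff)
  then have "x + y = of_int (a * d + c * b) / of_int (b * d)"
    using xy by (simp add: field_simps)
  then show ?thesis using nd unfolding padic_ints_def by blast
qed

lemma Zp_mult [intro]:
  assumes "x \<in> Zp" "y \<in> Zp" shows "x * y \<in> Zp"
proof -
  obtain a b c d where "\<not> int p dvd b" "\<not> int p dvd d"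
    and xy: "x = of_int a / of_int b" "y = of_int c / of_int d"
    using assms unfolding padic_ints_def by auto
  then have nd: "\<not> int p dvd b * d"
    using prime_int_p by (auto simp: prime_dvd_mult_iff)
  then have "x * y = of_int (a * c) / of_int (b * d)"
    using xy by simp
  then show ?thesis using nd unfolding padic_ints_def by blast
qed

lemma Zp_minus [intro]: "x \<in> Zp \<Longrightarrow> - x \<in> Zp"
  using Zp_mult[OF Zp_of_int[of "-1"], of x] by simp

lemma Zp_diff [intro]: "x \<in> Zp \<Longrightarrow> y \<in> Zp \<Longrightarrow> x - y \<in> Zp"
  using Zp_add[of x "- y"] Zp_minus[of y] by simp

lemma Zp_power [intro]: "x \<in> Zp \<Longrightarrow> x ^ n \<in> Zp"
  by (induction n) auto

lemma Zp_sum [intro]: "(\<And>i. i \<in> A \<Longrightarrow> f i \<in> Zp) \<Longrightarrow> sum f A \<in> Zp"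
  by (induction A rule: infinite_finite_induct) auto

lemma Zp_prod [intro]: "(\<And>i. i \<in> A \<Longrightarrow> f i \<in> Zp) \<Longrightarrow> prod f A \<in> Zp"
  by (induction A rule: infinite_finite_induct) auto

lemma Zp_inverse_int: "\<not> int p dvd b \<Longrightarrow> 1 / of_int b \<in> Zp"
  unfolding padic_ints_def by (intro CollectI exI[of _ 1] exI[of _ b]) simp

lemma Zp_inverse_nat: "\<not> p dvd n \<Longrightarrow> 1 / of_nat n \<in> Zp"
  using Zp_inverse_int[of "int n"] by simp

lemma Zp_inverse_less: "0 < n \<Longrightarrow> n < p \<Longrightarrow> 1 / of_nat n \<in> Zp"
  using Zp_inverse_nat[of n] dvd_imp_le[of p n] by linarith

lemma Zp_inverse_numeral: "numeral w < p \<Longrightarrow> 1 / numeral w \<in> Zp"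
  using Zp_inverse_less[of "numeral w"] by simp

lemma Zp_divide: "x \<in> Zp \<Longrightarrow> 1 / y \<in> Zp \<Longrightarrow> x / y \<in> Zp"
  using Zp_mult[of x "1 / y"] by simp

lemma Zp_divide_power: "x \<in> Zp \<Longrightarrow> 1 / y \<in> Zp \<Longrightarrow> x / y ^ n \<in> Zp"
  using Zp_mult[of x "(1 / y) ^ n"] Zp_power[of "1 / y" n] by (simp add: power_divide)

lemma Zp_divide_less: "x \<in> Zp \<Longrightarrow> 0 < n \<Longrightarrow> n < p \<Longrightarrow> x / of_nat n \<in> Zp"
  by (rule Zp_divide[OF _ Zp_inverse_less])

lemma Zp_divide_power_less: "x \<in> Zp \<Longrightarrow> 0 < n \<Longrightarrow> n < p \<Longrightarrow> x / of_nat n ^ s \<in> Zp"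
  by (rule Zp_divide_power[OF _ Zp_inverse_less])

text \<open>Turns the valuation condition into an exact equation with a \<open>p\<close>-integral
  cofactor; equality of \<open>x\<close> and \<open>y\<close> is the case \<open>z = 0\<close>. Both
  \<open>x\<close> and \<open>y\<close> may have \<open>p\<close> in their denominators.\<close>

lemma pc_iff: "pc r x y \<longleftrightarrow> (\<exists>z\<in>Zp. x - y = P ^ r * z)"
proof -
  obtain c d where cd: "quotient_of ((x - y) / P ^ r) = (c, d)"
    by fastforce
  have d: "d > 0" and eq: "(x - y) / P ^ r = of_int c / of_int d" and cop: "coprime c d"
    using quotient_of_denom_pos[OF cd] quotient_of_div[OF cd] quotient_of_coprime[OF cd] by auto
  have *: "coprime d (int p) \<longleftrightarrow> \<not> int p dvd d"
    using prime_int_p by (metis coprime_commute prime_imp_coprime coprime_absorb_left not_prime_unit)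
  have "\<not> int p dvd d \<longleftrightarrow> (x - y) / P ^ r \<in> Zp"
  proof
    assume "(x - y) / P ^ r \<in> Zp"
    then obtain a b where ab: "\<not> int p dvd b" "(x - y) / P ^ r = of_int a / of_int b"
      unfolding padic_ints_def by auto
    then have "b \<noteq> 0" by auto
    with ab eq d have "(of_int (a * d) :: rat) = of_int (c * b)"
      by (simp add: field_simps)
    then have e: "a * d = c * b" by (simp only: of_int_eq_iff)
    show "\<not> int p dvd d"
    proof
      assume pd: "int p dvd d"
      then have "int p dvd c * b" using e by (metis dvd_mult)
      then have "int p dvd c" using ab prime_int_p by (simp add: prime_dvd_mult_iff)
      then show False using pd cop prime_int_p by (meson coprime_common_divisor not_prime_unit)
    qed
  qed (use eq in \<open>auto simp: padic_ints_def\<close>)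
  also have "(x - y) / P ^ r \<in> Zp \<longleftrightarrow> (\<exists>z\<in>Zp. x - y = P ^ r * z)"
  proof -
    have "x - y = P ^ r * z \<longleftrightarrow> z = (x - y) / P ^ r" for z
      using p_pos by (auto simp: field_simps)
    then show ?thesis by auto
  qed
  finally show ?thesis
    using padic_cong_iff_denominator[OF prime_p] cd * by simp
qed

lemma pcI: "z \<in> Zp \<Longrightarrow> x - y = P ^ r * z \<Longrightarrow> pc r x y"
  by (auto simp: pc_iff)

lemma pc_refl [simp, intro]: "pc r x x"
  by (rule pcI[of 0]) auto

lemma pc_sym: "pc r x y \<Longrightarrow> pc r y x"
proof -
  assume "pc r x y"
  then obtain z where "z \<in> Zp" "x - y = P ^ r * z" unfolding pc_iff by blast
  then show ?thesis by (intro pcI[of "- z"]) (auto simp: algebra_simps)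
qed

lemma pc_add:
  assumes "pc r x y" "pc r x' y'" shows "pc r (x + x') (y + y')"
proof -
  obtain z z' where "z \<in> Zp" "x - y = P ^ r * z" "z' \<in> Zp" "x' - y' = P ^ r * z'"
    using assms unfolding pc_iff by blast
  then show ?thesis by (intro pcI[of "z + z'"]) (auto simp: distrib_left)
qed

lemma pc_trans [trans]:
  assumes "pc r x y" "pc r y z" shows "pc r x z"
proof -
  obtain u v where "u \<in> Zp" "x - y = P ^ r * u" "v \<in> Zp" "y - z = P ^ r * v"
    using assms unfolding pc_iff by blast
  then show ?thesis by (intro pcI[of "u + v"]) (auto simp: distrib_left)
qed

lemma pc_mult_left:
  assumes "z \<in> Zp" "pc r x y" shows "pc r (z * x) (z * y)"
proof -
  obtain u where "u \<in> Zp" "x - y = P ^ r * u"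
    using assms(2) unfolding pc_iff by blast
  then show ?thesis using assms(1)
    by (intro pcI[of "z * u"]) (auto simp: right_diff_distrib[symmetric])
qed

lemma pc_mult_right: "z \<in> Zp \<Longrightarrow> pc r x y \<Longrightarrow> pc r (x * z) (y * z)"
  using pc_mult_left[of z r x y] by (simp only: mult.commute[of z])

lemma pc_minus: "pc r x y \<Longrightarrow> pc r (- x) (- y)"
  using pc_mult_left[of "- 1" r x y] Zp_minus[OF Zp_1] by simp

lemma pc_diff: "pc r x y \<Longrightarrow> pc r x' y' \<Longrightarrow> pc r (x - x') (y - y')"
  using pc_add[of r x y "- x'" "- y'"] pc_minus by simp

text \<open>From \<open>x * x' - y * y' = x * (x' - y') + (x - y) * y'\<close>, where
  \<open>x\<close> and \<open>y'\<close> occur as cofactors.\<close>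

lemma pc_mult:
  assumes "pc r x y" "pc r x' y'" "x \<in> Zp" "y' \<in> Zp"
  shows "pc r (x * x') (y * y')"
  using pc_trans[OF pc_mult_left[OF assms(3,2)] pc_mult_right[OF assms(4,1)]] .

lemma pc_integral:
  assumes "pc r x y" "y \<in> Zp" shows "x \<in> Zp"
proof -
  obtain z where "z \<in> Zp" "x - y = P ^ r * z" using assms(1) pc_iff by blast
  then have "x = y + P ^ r * z" by simp
  then show ?thesis using assms(2) \<open>z \<in> Zp\<close> by (metis Zp_add Zp_mult Zp_of_nat Zp_power)
qed

lemma pc_power:
  assumes "pc r x y" "x \<in> Zp" "y \<in> Zp" shows "pc r (x ^ n) (y ^ n)"
  by (induction n) (use assms in \<open>auto intro!: pc_mult\<close>)

lemma pc_sum: "(\<And>i. i \<in> A \<Longrightarrow> pc r (f i) (g i)) \<Longrightarrow> pc r (sum f A) (sum g A)"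
  by (induction A rule: infinite_finite_induct) (auto intro: pc_add)

lemma pc_prod:
  "(\<And>i. i \<in> A \<Longrightarrow> pc r (f i) (g i) \<and> f i \<in> Zp \<and> g i \<in> Zp) \<Longrightarrow> pc r (prod f A) (prod g A)"
  by (induction A rule: infinite_finite_induct) (auto intro!: pc_mult Zp_prod)

lemma pc_mono:
  assumes "pc r x y" "s \<le> r" shows "pc s x y"
proof -
  obtain z where "z \<in> Zp" "x - y = P ^ r * z" using assms(1) unfolding pc_iff by blast
  moreover have "P ^ r = P ^ s * P ^ (r - s)" using assms(2) by (simp flip: power_add)
  ultimately show ?thesis 
    by (intro pcI[of "P ^ (r - s) * z"] Zp_mult Zp_power Zp_of_nat) auto
qed

lemma pc_scale:
  assumes "pc r x y" shows "pc (s + r) (P ^ s * x) (P ^ s * y)"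
proof -
  obtain z where "z \<in> Zp" "x - y = P ^ r * z" using assms(1) unfolding pc_iff by blast
  then show ?thesis
    by (intro pcI[of z]) (auto simp: power_add right_diff_distrib[symmetric])
qed

text \<open>Division by \<open>p^s\<close> costs \<open>s\<close> powers of the modulus, so a
  quantity that will be divided by \<open>p\<close> is first computed to one higher power.\<close>

lemma pc_unscale: "pc (s + r) (P ^ s * x) (P ^ s * y) \<Longrightarrow> pc r x y"
  unfolding pc_iff using p_pos by (auto simp: power_add mult.assoc right_diff_distrib[symmetric])

lemma pc_scale_1: "pc 1 x y \<Longrightarrow> pc 2 (P * x) (P * y)"
  using pc_scale[of 1 x y 1] by (simp add: numeral_2_eq_2)

lemma pc_unscale_1: "pc 2 (P * x) (P * y) \<Longrightarrow> pc 1 x y"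
  using pc_unscale[of 1 1 x y] by (simp add: numeral_2_eq_2)

lemma pc_unscale_2: "pc 3 (P * x) (P * y) \<Longrightarrow> pc 2 x y"
  using pc_unscale[of 1 2 x y] by (simp add: numeral_3_eq_3)

lemma pc_euclidean: "pc r x y \<Longrightarrow> pc r x z \<Longrightarrow> pc r y z"
  by (rule pc_trans[OF pc_sym])

lemma pc_multiple: "z \<in> Zp \<Longrightarrow> pc r (P ^ r * z) 0"
  by (rule pcI[of z]) auto

lemma pc_multiple_1: "z \<in> Zp \<Longrightarrow> pc 1 (P * z) 0"
  using pc_multiple[of z 1] by simp

lemma pc_cancel:
  assumes "pc r (u * x) (u * y)" "1 / u \<in> Zp" "u \<noteq> 0" shows "pc r x y"
  using pc_mult_left[OF assms(2,1)] assms(3) by simp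

lemma pc_inverse:
  assumes "pc r x y" "1 / x \<in> Zp" "1 / y \<in> Zp" "x \<noteq> 0" "y \<noteq> 0"
  shows "pc r (1 / x) (1 / y)"
proof -
  have "pc r (1 / x * (1 / y) * y) (1 / x * (1 / y) * x)"
    by (rule pc_mult_left) (use assms in \<open>auto intro: pc_sym Zp_mult simp del: times_divide_eq_left times_divide_eq_right\<close>)
  then show ?thesis using assms by (simp add: field_simps)
qed

lemma pc_of_int: "int p ^ r dvd a - b \<Longrightarrow> pc r (of_int a) (of_int b)"
proof -
  assume "int p ^ r dvd a - b"
  then obtain k where "a - b = int p ^ r * k" ..
  then have "(of_int a - of_int b :: rat) = P ^ r * of_int k"
    by (metis of_int_diff of_int_mult of_int_of_nat_eq of_int_power)
  then show ?thesis by (intro pcI[of "of_int k"]) auto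
qed

lemma inverse_minus_p:
  assumes "0 < j" "j < p" shows "pc 1 (1 / (P - of_nat j)) (- 1 / of_nat j)"
proof -
  have "1 / (P - of_nat j) \<in> Zp"
    using Zp_inverse_less[of "p - j"] assms by (simp add: of_nat_diff)
  moreover have "1 / (of_nat j) \<in> Zp"
    using Zp_inverse_less assms by simp
  moreover have "1 / (P - of_nat j) - (- 1 / of_nat j) = P ^ 1 * (1 / (P - of_nat j) * (1 / of_nat j))"
    using assms by (simp add: field_simps)
  ultimately show ?thesis by (blast intro: pcI)
qed

end

section \<open>The telescoping identity\<close>

fun esym :: "nat \<Rightarrow> nat \<Rightarrow> rat" where
  "esym 0 k = 1"
| "esym (Suc r) k = (\<Sum>m\<in>{1..<k}. esym r m / of_nat m ^ 2)"

text \<open>For \<open>0 < k < p\<close> the denominator contains \<open>p\<close> at most once, so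
  \<open>P * tcb k\<close> is \<open>p\<close>-integral (\<open>Zp_P_tcb\<close>).\<close>

definition tcb :: "nat \<Rightarrow> rat" where
  "tcb k = 1 / (of_nat k ^ 2 * of_nat ((2 * k) choose k))"

definition apery_weight :: "nat \<Rightarrow> nat \<Rightarrow> rat" where
  "apery_weight n k = fact (k - 1) ^ 2 * fact (n - k) / fact (n + k)"

definition apery_sum :: "(nat \<Rightarrow> rat) \<Rightarrow> nat \<Rightarrow> rat" where
  "apery_sum f n = (\<Sum>k=1..n. (-1) ^ (n + k) * apery_weight n k * f k)"

lemma tcb_fact: "k > 0 \<Longrightarrow> tcb k = fact (k - 1) ^ 2 / fact (2 * k)"
proof -
  assume k: "k > 0"
  have "of_nat ((2 * k) choose k) = fact (2 * k) / (fact k * fact (2 * k - k) :: rat)"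
    by (rule binomial_fact) simp
  moreover have "2 * k - k = k" by simp
  moreover have "fact k = of_nat k * (fact (k - 1) :: rat)" using k by (rule fact_reduce)
  ultimately show ?thesis using k by (simp add: tcb_def power2_eq_square)
qed

lemma sum_alternating_telescope:
  fixes D :: "nat \<Rightarrow> rat"
  shows "(\<Sum>k=1..<Suc n. (-1) ^ k * (D k + D (Suc k))) = (-1) ^ n * D (Suc n) - D 1"
  by (induction n) (auto simp: algebra_simps)

text \<open>Adding the weights for \<open>n\<close> and \<open>n - 1\<close> produces a factor
  \<open>2 * n\<close>. Against \<open>n^2 * f k + g k\<close>, the difference equation for
  \<open>f\<close> then splits the summand into \<open>D k + D (k + 1)\<close>, and the alternating
  sum telescopes. The boundary terms at \<open>k = 1\<close> and \<open>k = n\<close> supply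
  \<open>f 1\<close> and \<open>tcb n\<close>.\<close>

lemma apery_sum_step:
  fixes f g :: "nat \<Rightarrow> rat"
  assumes fg: "\<And>k. 1 \<le> k \<Longrightarrow> k < n \<Longrightarrow> of_nat k ^ 2 * (f (Suc k) - f k) = g k"
    and n: "n \<ge> 1"
  shows "of_nat n ^ 2 * (apery_sum f n - apery_sum f (n - 1)) + (apery_sum g n - apery_sum g (n - 1))
    = 2 * (-1) ^ (n - 1) * f 1 + tcb n * (g n - 3 * of_nat n ^ 2 * f n)"
proof -
  define D where "D k = fact (k - 1) ^ 2 * fact (n - k) / fact (n + k - 1) * f k" for k
  define N :: rat where "N = of_nat n"
  have N: "N \<noteq> 0" using n by (simp add: N_def)
  have diff: "apery_sum h n - apery_sum h (n - 1) =
      (\<Sum>k=1..<n. (-1) ^ (n + k) * (apery_weight n k + apery_weight (n - 1) k) * h k) + tcb n * h n" for h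
  proof -
    obtain m where m: "n = Suc m" using n by (cases n) auto
    have "apery_weight n n = tcb n"
      using n by (simp add: apery_weight_def tcb_fact mult_2)
    then show ?thesis
      by (simp add: apery_sum_def m sum.distrib[symmetric] sum_subtractf[symmetric] atLeastLessThanSuc_atLeastAtMost
          algebra_simps flip: mult_2)
  qed
  have key: "(apery_weight n k + apery_weight (n - 1) k) * (N ^ 2 * f k + g k) = 2 * N * (D k + D (Suc k))"
    if k: "1 \<le> k" "k < n" for k
  proof -
    obtain a where a: "k = Suc a" using k by (cases k) auto
    obtain d where d: "n = Suc (k + d)" using k less_iff_Suc_add by auto
    have Nd: "N = of_nat k + of_nat d + 1" by (simp add: N_def d)
    have f1: "fact (n - k) = (of_nat d + 1) * (fact d :: rat)"
      by (simp add: d algebra_simps)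
    have f2: "fact (n + k) = (N + of_nat k) * (fact (n + k - 1) :: rat)"
      using n by (simp add: N_def fact_reduce[of "n + k"])
    have f3: "fact k = of_nat k * (fact a :: rat)" by (simp add: a)
    have nz: "N + of_nat k \<noteq> 0" using n by (simp add: N_def flip: of_nat_add)
    have w1: "apery_weight n k = fact a ^ 2 * ((of_nat d + 1) * fact d) / ((N + of_nat k) * fact (n + k - 1))"
      by (simp only: apery_weight_def f1 f2) (simp add: a)
    have w2: "apery_weight (n - 1) k = fact a ^ 2 * fact d / fact (n + k - 1)"
      using d by (simp add: apery_weight_def a)
    have D1: "D k = fact a ^ 2 * ((of_nat d + 1) * fact d) / fact (n + k - 1) * f k"
      by (simp only: D_def f1) (simp add: a)
    have D2: "D (Suc k) = (of_nat k * fact a) ^ 2 * fact d / ((N + of_nat k) * fact (n + k - 1)) * f (Suc k)"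
      using f2 by (simp add: D_def f3 d)
    have "of_nat k ^ 2 * f (Suc k) = of_nat k ^ 2 * f k + g k" using fg[OF k] by (simp add: algebra_simps)
    then have D2': "D (Suc k) = fact a ^ 2 * fact d / ((N + of_nat k) * fact (n + k - 1)) * (of_nat k ^ 2 * f k + g k)"
      unfolding D2 by (simp add: power_mult_distrib)
    \<comment> \<open>All terms are multiples of \<open>W\<close>; what remains is
      \<open>(d + 1) + (n + k) = 2 * n\<close> and
      \<open>(n - k) * (n + k) + k^2 = n^2\<close>.\<close>
    define W :: rat where "W = fact a ^ 2 * fact d / ((N + of_nat k) * fact (n + k - 1))"
    have W1: "apery_weight n k = (of_nat d + 1) * W" unfolding w1 W_def by simp
    have W2: "apery_weight (n - 1) k = (N + of_nat k) * W" unfolding w2 W_def using nz by simp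
    have D1': "D k = (of_nat d + 1) * (N + of_nat k) * W * f k" unfolding D1 W_def using nz by simp
    show ?thesis unfolding W1 W2 D1' D2'[folded W_def]
      by (simp add: Nd algebra_simps power2_eq_square)
  qed
  have t: "D n = 2 * N * (tcb n * f n)"
  proof -
    have "fact (2 * n) = 2 * N * (fact (2 * n - 1) :: rat)"
      using n by (simp add: N_def fact_reduce[of "2 * n"])
    moreover have "D n = fact (n - 1) ^ 2 / fact (2 * n - 1) * f n"
      by (simp add: D_def mult_2)
    ultimately show ?thesis using n N by (simp add: tcb_fact)
  qed
  have D1: "N * D 1 = f 1"
    using n by (simp add: D_def N_def fact_reduce[of n])
  have "of_nat n ^ 2 * (apery_sum f n - apery_sum f (n - 1)) + (apery_sum g n - apery_sum g (n - 1)) =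
    (\<Sum>k=1..<n. (-1) ^ (n + k) * ((apery_weight n k + apery_weight (n - 1) k) * (N ^ 2 * f k + g k)))
    + tcb n * (N ^ 2 * f n + g n)"
    unfolding diff N_def[symmetric]
    by (simp add: sum_distrib_left algebra_simps sum.distrib)
  also have "(\<Sum>k=1..<n. (-1) ^ (n + k) * ((apery_weight n k + apery_weight (n - 1) k) * (N ^ 2 * f k + g k)))
     = 2 * N * (-1) ^ n * (\<Sum>k=1..<n. (-1) ^ k * (D k + D (Suc k)))"
    unfolding sum_distrib_left
  proof (rule sum.cong)
    fix k assume "k \<in> {1..<n}"
    then show "(-1) ^ (n + k) * ((apery_weight n k + apery_weight (n - 1) k) * (N ^ 2 * f k + g k))
      = 2 * N * (-1) ^ n * ((-1) ^ k * (D k + D (Suc k)))"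
      using key[of k] by (simp add: power_add)
  qed simp
  also have "(\<Sum>k=1..<n. (-1) ^ k * (D k + D (Suc k))) = (-1) ^ (n - 1) * D n - D 1"
    using sum_alternating_telescope[of D "n - 1"] n by simp
  also have "2 * N * (-1) ^ n * ((-1) ^ (n - 1) * D n - D 1) = - 2 * N * D n + 2 * (-1) ^ (n - 1) * (N * D 1)"
  proof -
    obtain m where m: "n = Suc m" using n by (cases n) auto
    have "(-1) ^ m * (-1) ^ m = (1 :: rat)" by (simp flip: power_add mult_2)
    then show ?thesis unfolding m by (simp add: algebra_simps)
  qed
  finally show ?thesis unfolding D1 t unfolding N_def
    by (simp add: algebra_simps power2_eq_square)
qed

lemma esym_Suc: "k \<ge> 1 \<Longrightarrow> of_nat k ^ 2 * (esym (Suc r) (Suc k) - esym (Suc r) k) = esym r k"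
  by simp

text \<open>The coefficient of \<open>x^2\<close> in \<open>apery_sum_vprod\<close>, because
  \<open>vprod x k\<close> is the sum of \<open>(-x)^r * esym r k\<close>. It is derived directly by
  applying the step to \<open>esym 0\<close>, \<open>esym 1\<close>, \<open>esym 2\<close> and
  eliminating the first two increments.\<close>

lemma apery_sum_esym2:
  "apery_sum (esym 2) n = (\<Sum>k=1..n. tcb k * (4 * esym 1 k / of_nat k ^ 2 - 3 * esym 2 k - 4 / of_nat k ^ 4)
      + 2 * (-1) ^ (k - 1) / of_nat k ^ 6)"
proof (induction n)
  case (Suc n)
  let ?d = "\<lambda>f. apery_sum f (Suc n) - apery_sum f n" and ?N = "of_nat (Suc n) :: rat"
  have 0: "apery_sum (\<lambda>_. 0) m = 0" for m by (simp add: apery_sum_def)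
  have d0: "?N ^ 2 * ?d (esym 0) = 2 * (-1) ^ n - tcb (Suc n) * 3 * ?N ^ 2"
    using apery_sum_step[of "Suc n" "esym 0" "\<lambda>_. 0"] 0 by simp
  have d1: "?N ^ 2 * ?d (esym 1) + ?d (esym 0) = tcb (Suc n) * (1 - 3 * ?N ^ 2 * esym 1 (Suc n))"
    using apery_sum_step[of "Suc n" "esym 1" "esym 0"] esym_Suc[of _ 0] by simp
  have d2: "?N ^ 2 * ?d (esym 2) + ?d (esym 1) = tcb (Suc n) * (esym 1 (Suc n) - 3 * ?N ^ 2 * esym 2 (Suc n))"
    using apery_sum_step[of "Suc n" "esym 2" "esym 1"] esym_Suc[of _ 1]
    by (simp add: numeral_2_eq_2)
  have N: "?N \<noteq> 0" by (metis of_nat_eq_0_iff nat.distinct(1))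
  define x y z e1 e2 t s M where "x = ?d (esym 0)" and "y = ?d (esym 1)" and "z = ?d (esym 2)"
    and "e1 = esym 1 (Suc n)" and "e2 = esym 2 (Suc n)" and "t = tcb (Suc n)" and "s = ((-1) ^ n :: rat)"
    and "M = ?N"
  have M: "M \<noteq> 0" using N M_def by simp
  have xeq: "x = 2 * s / M ^ 2 - 3 * t"
    using d0 M unfolding x_def[symmetric] t_def[symmetric] s_def[symmetric] M_def[symmetric] by (simp add: field_simps)
  have yeq: "y = t * (1 - 3 * M ^ 2 * e1) / M ^ 2 - x / M ^ 2"
  proof -
    have "M ^ 2 * y = t * (1 - 3 * M ^ 2 * e1) - x"
      using d1 unfolding x_def[symmetric] y_def[symmetric] t_def[symmetric] M_def[symmetric] e1_def[symmetric]
      by simp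
    then show ?thesis using M by (metis diff_divide_distrib nonzero_mult_div_cancel_left power_not_zero)
  qed
  have zeq: "z = t * (e1 - 3 * M ^ 2 * e2) / M ^ 2 - y / M ^ 2"
  proof -
    have "M ^ 2 * z = t * (e1 - 3 * M ^ 2 * e2) - y"
      using d2 unfolding z_def[symmetric] y_def[symmetric] t_def[symmetric] M_def[symmetric] e1_def[symmetric] e2_def[symmetric]
      by simp
    then show ?thesis using M by (metis diff_divide_distrib nonzero_mult_div_cancel_left power_not_zero)
  qed
  have "z = t * (4 * e1 / M ^ 2 - 3 * e2 - 4 / M ^ 4) + 2 * s / M ^ 6"
    unfolding zeq yeq xeq using M by (simp add: divide_simps) (simp add: algebra_simps)
  then have "?d (esym 2) = tcb (Suc n) * (4 * esym 1 (Suc n) / ?N ^ 2 - 3 * esym 2 (Suc n) - 4 / ?N ^ 4)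
      + 2 * (-1) ^ (Suc n - 1) / ?N ^ 6"
    by (simp only: z_def e1_def e2_def t_def s_def M_def diff_Suc_1)
  then show ?case using Suc by (simp del: esym.simps of_nat_Suc)
qed (simp add: apery_sum_def)

definition vprod :: "rat \<Rightarrow> nat \<Rightarrow> rat" where
  "vprod x k = (\<Prod>m\<in>{1..<k}. 1 - x / of_nat m ^ 2)"

lemma vprod_Suc: "k \<ge> 1 \<Longrightarrow> vprod x (Suc k) = vprod x k * (1 - x / of_nat k ^ 2)"
  by (simp add: vprod_def)

text \<open>\<open>vprod x\<close> solves the difference equation with \<open>g = - x * f\<close>,
  so the step lemma closes on itself: the increment appears multiplied by \<open>n^2 - x\<close>,
  and the hypothesis permits division by it.\<close>

lemma apery_sum_vprod:
  assumes "\<And>k. 1 \<le> k \<Longrightarrow> k \<le> n \<Longrightarrow> of_nat k ^ 2 \<noteq> x"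
  shows "apery_sum (vprod x) n = (\<Sum>k=1..n. 2 * (-1) ^ (k - 1) / (of_nat k ^ 2 - x))
     - (\<Sum>k=1..n. tcb k * vprod x k * (3 * of_nat k ^ 2 + x) / (of_nat k ^ 2 - x))"
  using assms
proof (induction n)
  case (Suc n)
  let ?d = "\<lambda>f. apery_sum f (Suc n) - apery_sum f n" and ?N = "of_nat (Suc n) :: rat"
  have s: "apery_sum (\<lambda>k. - x * vprod x k) m = - x * apery_sum (vprod x) m" for m
    by (simp add: apery_sum_def sum_distrib_left mult_ac sum_negf)
  have nz: "?N ^ 2 - x \<noteq> 0" using Suc.prems[of "Suc n"] by simp
  have v1: "vprod x (Suc 0) = 1" by (simp add: vprod_def)
  have "?N ^ 2 * ?d (vprod x) + ?d (\<lambda>k. - x * vprod x k) = 2 * (-1) ^ n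
      + tcb (Suc n) * (- x * vprod x (Suc n) - 3 * ?N ^ 2 * vprod x (Suc n))"
    using apery_sum_step[of "Suc n" "vprod x" "\<lambda>k. - x * vprod x k"] v1
    by (simp add: vprod_Suc field_simps del: of_nat_Suc)
  then have "(?N ^ 2 - x) * ?d (vprod x) = 2 * (-1) ^ n - tcb (Suc n) * vprod x (Suc n) * (3 * ?N ^ 2 + x)"
    unfolding s by (simp add: algebra_simps del: of_nat_Suc)
  then have "?d (vprod x) = 2 * (-1) ^ n / (?N ^ 2 - x) - tcb (Suc n) * vprod x (Suc n) * (3 * ?N ^ 2 + x) / (?N ^ 2 - x)"
    using nz by (metis diff_divide_distrib nonzero_mult_div_cancel_left)
  then show ?case using Suc by (simp del: of_nat_Suc)
qed (simp add: apery_sum_def)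

section \<open>Exact evaluation at the square of an odd number\<close>

text \<open>\<open>cos6 n = 2 cos (n \<pi> / 3)\<close>, which is an integer.\<close>

fun cos6 :: "nat \<Rightarrow> int" where
  "cos6 0 = 2"
| "cos6 (Suc 0) = 1"
| "cos6 (Suc (Suc n)) = cos6 (Suc n) - cos6 n"

lemma cos6_mod: "cos6 n = cos6 (n mod 6)"
proof (induction n rule: less_induct)
  case (less n)
  show ?case
  proof (cases "n < 6")
    case False
    then obtain m where m: "n = m + 6" by (metis add.commute le_Suc_ex not_less)
    have "cos6 (m + 6) = cos6 m" by (simp add: numeral_eq_Suc)
    then show ?thesis using less.IH[of m] m by simp
  qed simp
qed

lemma choose_second_difference:
  "int (Suc (Suc m) choose Suc (Suc j)) - 2 * int (Suc m choose Suc (Suc j)) + int (m choose Suc (Suc j)) = int (m choose j)"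
  by simp

text \<open>The Morgan-Voyce polynomial with coefficients \<open>C(n + k, 2 k)\<close> at the point
  \<open>-1\<close>, where its three-term recurrence becomes that of \<open>cos6\<close>.\<close>

definition alt_choose_sum :: "nat \<Rightarrow> int" where
  "alt_choose_sum n = (\<Sum>k\<le>n. (-1) ^ k * int ((n + k) choose (2 * k)))"

lemma alt_choose_sum_extend:
  assumes "n \<le> N"
  shows "alt_choose_sum n = (\<Sum>k\<le>N. (-1) ^ k * int ((n + k) choose (2 * k)))"
  unfolding alt_choose_sum_def using assms by (intro sum.mono_neutral_left) auto

text \<open>By Pascal's rule the second difference in \<open>n\<close> of
  \<open>C(n + k, 2 k)\<close> lowers \<open>k\<close> by one, which flips the sign. The three sums
  are first extended by vanishing binomials to a common range.\<close>

lemma alt_choose_sum_rec: "alt_choose_sum (Suc (Suc n)) = alt_choose_sum (Suc n) - alt_choose_sum n"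
proof -
  let ?s = "\<lambda>n N. \<Sum>k\<le>N. (-1) ^ k * int ((n + k) choose (2 * k))"
  have e: "int ((Suc (Suc n) + Suc k) choose (2 * Suc k)) - 2 * int ((Suc n + Suc k) choose (2 * Suc k))
      + int ((n + Suc k) choose (2 * Suc k)) = int ((Suc n + k) choose (2 * k))" for k
    using choose_second_difference[of "n + Suc k" "2 * k"] by simp
  have sh: "?s m (Suc N) = 1 - (\<Sum>k\<le>N. (-1) ^ k * int ((m + Suc k) choose (2 * Suc k)))" for m N
    by (subst sum.atMost_Suc_shift) (simp add: sum_negf del: mult_Suc_right)
  have "alt_choose_sum (Suc (Suc n)) - 2 * alt_choose_sum (Suc n) + alt_choose_sum n
     = ?s (Suc (Suc n)) (Suc (Suc n)) - 2 * ?s (Suc n) (Suc (Suc n)) + ?s n (Suc (Suc n))"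
    by (simp only: alt_choose_sum_extend[of n "Suc (Suc n)"] alt_choose_sum_extend[of "Suc n" "Suc (Suc n)"]
      alt_choose_sum_extend[of "Suc (Suc n)" "Suc (Suc n)"] order_refl le_SucI)
  also have "\<dots> = - (\<Sum>k\<le>Suc n. (-1) ^ k * (int ((Suc (Suc n) + Suc k) choose (2 * Suc k))
      - 2 * int ((Suc n + Suc k) choose (2 * Suc k)) + int ((n + Suc k) choose (2 * Suc k))))"
    unfolding sh
    by (simp add: sum_subtractf sum.distrib sum_distrib_left algebra_simps del: mult_Suc_right add_Suc_right add_Suc binomial_Suc_Suc sum.atMost_Suc)
  also have "\<dots> = - ?s (Suc n) (Suc n)" unfolding e ..
  finally show ?thesis by (simp add: alt_choose_sum_def)
qed

lemma alt_choose_sum_cos6: "alt_choose_sum (Suc n) + alt_choose_sum n = cos6 (Suc n)"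
proof (induction n rule: induct_nat_012)
  case 0
  have "Suc (Suc 0) choose 2 = Suc 0" by (simp add: numeral_2_eq_2)
  then show ?case by (simp add: alt_choose_sum_def)
next
  case 1
  have "Suc (Suc 0) choose 2 = Suc 0" by (simp add: numeral_2_eq_2)
  then show ?case by (simp add: alt_choose_sum_def numeral_eq_Suc)
next
  case (ge2 n)
  then show ?case by (simp add: alt_choose_sum_rec)
qed

lemma vprod_square:
  assumes "1 \<le> k" "k \<le> n"
  shows "vprod (of_nat n ^ 2) k = (-1) ^ (k - 1) * fact (n + k - 1) / (fact (k - 1) ^ 2 * fact (n - k) * of_nat n)"
  using assms
proof (induction k rule: nat_induct_at_least)
  case base
  then show ?case by (simp add: vprod_def fact_reduce[of n])
next
  case (Suc k)
  obtain a where a: "k = Suc a" using Suc by (cases k) auto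
  obtain d where d: "n = Suc (k + d)" using Suc.prems less_iff_Suc_add by (auto simp: Suc_le_eq)
  have f1: "fact (n - k) = (of_nat d + 1) * (fact d :: rat)"
    by (simp add: d algebra_simps)
  have f2: "fact (n + k) = (of_nat n + of_nat k) * (fact (n + k - 1) :: rat)"
    using Suc by (simp add: fact_reduce[of "n + k"])
  have K: "of_nat k \<noteq> (0::rat)" and N: "of_nat n \<noteq> (0 :: rat)" using a d by auto
  have D: "of_nat d + 1 = (of_nat n - of_nat k :: rat)" by (simp add: d)
  have D0: "of_nat n - of_nat k \<noteq> (0::rat)" unfolding D[symmetric] by (metis of_nat_Suc of_nat_neq_0 add.commute)
  have "vprod (of_nat n ^ 2) (Suc k) = vprod (of_nat n ^ 2) k * ((of_nat k - of_nat n) * (of_nat k + of_nat n) / of_nat k ^ 2)"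
    using K Suc by (simp add: vprod_Suc field_simps power2_eq_square)
  also have "vprod (of_nat n ^ 2) k = (-1) ^ a * fact (n + k - 1) / (fact a ^ 2 * ((of_nat d + 1) * fact d) * of_nat n)"
    using Suc unfolding f1[symmetric] by (simp add: a del: fact_Suc of_nat_Suc)
  also have "\<dots> * ((of_nat k - of_nat n) * (of_nat k + of_nat n) / of_nat k ^ 2) =
     (-1) ^ k * ((of_nat n + of_nat k) * fact (n + k - 1)) / ((of_nat k * fact a) ^ 2 * fact d * of_nat n)"
  proof -
    have "s * F / (A ^ 2 * (x * H) * m) * ((- x) * y / l ^ 2) = (- s) * (y * F) / ((l * A) ^ 2 * H * m)"
      if "x \<noteq> 0" for s F A x H m y l :: rat
      using that by (simp add: power_mult_distrib mult_ac)
    from this[OF D0, of "(-1) ^ a" "fact (n + k - 1)" "fact a" "fact d" "of_nat n" "of_nat n + of_nat k" "of_nat k"]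
    show ?thesis unfolding D by (simp add: a add.commute)
  qed
  also have "\<dots> = (-1) ^ (Suc k - 1) * fact (n + Suc k - 1) / (fact (Suc k - 1) ^ 2 * fact (n - Suc k) * of_nat n)"
    unfolding f2[symmetric] by (simp add: a d)
  finally show ?case .
qed

text \<open>Two forms for two uses: the sum of neighbouring binomials matches
  \<open>alt_choose_sum n + alt_choose_sum (n - 1)\<close>, while for \<open>n = p\<close> the
  single binomial shows that the denominator contains only one factor \<open>p\<close>.\<close>

lemma tcb_vprod_square:
  assumes k: "1 \<le> k" "k < n"
  shows "tcb k * vprod (of_nat n ^ 2) k =
    (-1) ^ (k - 1) * of_nat (((n + k) choose (2 * k)) + ((n + k - 1) choose (2 * k))) / (2 * of_nat n ^ 2)"
    and "tcb k * vprod (of_nat n ^ 2) k = (-1) ^ (k - 1) * of_nat ((n + k) choose (2 * k)) / (of_nat n * of_nat (n + k))"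
proof -
  obtain d where d: "n = Suc (k + d)" using k less_iff_Suc_add by auto
  have f1: "fact (n - k) = (of_nat d + 1) * (fact d :: rat)"
    by (simp add: d algebra_simps)
  have f2: "fact (n + k) = of_nat (n + k) * (fact (n + k - 1) :: rat)"
    using k by (simp add: fact_reduce[of "n + k"])
  have N: "of_nat n \<noteq> (0 :: rat)" using d by auto
  have NK: "of_nat (n + k) \<noteq> (0 :: rat)" using d by auto
  have D0: "of_nat d + 1 \<noteq> (0::rat)" by (metis of_nat_Suc of_nat_neq_0 add.commute)
  define F G H where "F = (fact (n + k - 1) :: rat)" and "G = (fact (2 * k) :: rat)" and "H = (fact d :: rat)"
  have FGH: "F \<noteq> 0" "G \<noteq> 0" "H \<noteq> 0" by (auto simp: F_def G_def H_def)
  have t: "tcb k * vprod (of_nat n ^ 2) k = (-1) ^ (k - 1) * F / (((of_nat d + 1) * H) * of_nat n * G)"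
  proof -
    have "tcb k * vprod (of_nat n ^ 2) k = fact (k - 1) ^ 2 / G * ((-1) ^ (k - 1) * F / (fact (k - 1) ^ 2 * fact (n - k) * of_nat n))"
      using k unfolding F_def G_def by (simp add: tcb_fact vprod_square)
    then show ?thesis unfolding f1 H_def by simp
  qed
  have c1: "of_nat ((n + k) choose (2 * k)) = of_nat (n + k) * F / (G * ((of_nat d + 1) * H))"
  proof -
    have "n + k - 2 * k = n - k" by simp
    then show ?thesis using k unfolding F_def G_def H_def f1[symmetric] f2[symmetric] by (simp add: binomial_fact)
  qed
  have c2: "of_nat ((n + k - 1) choose (2 * k)) = F / (G * H)"
    using k unfolding F_def G_def H_def by (simp add: binomial_fact d)
  show "tcb k * vprod (of_nat n ^ 2) k = (-1) ^ (k - 1) * of_nat ((n + k) choose (2 * k)) / (of_nat n * of_nat (n + k))"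
    unfolding t c1 using FGH N NK D0 by (simp add: mult_ac)
  have e: "of_nat (n + k) + (of_nat d + 1) = (2 * of_nat n :: rat)" by (simp add: d)
  have c: "of_nat (((n + k) choose (2 * k)) + ((n + k - 1) choose (2 * k)))
      = (of_nat (n + k) + (of_nat d + 1)) * F / (G * ((of_nat d + 1) * H))"
  proof -
    have "m * F / (G * (x * H)) + F / (G * H) = (m + x) * F / (G * (x * H))" if "x \<noteq> 0" for m x :: rat
      using that by (simp add: add_divide_distrib distrib_right)
    from this[OF D0] show ?thesis
      unfolding of_nat_add[of "(n + k) choose (2 * k)"] c1 c2 .
  qed
  show "tcb k * vprod (of_nat n ^ 2) k =
    (-1) ^ (k - 1) * of_nat (((n + k) choose (2 * k)) + ((n + k - 1) choose (2 * k))) / (2 * of_nat n ^ 2)"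
  proof -
    have "s * F / ((x * H) * m * G) = s * (2 * m * F / (G * (x * H))) / (2 * m ^ 2)" if "m \<noteq> 0" for s m x :: rat
      using that by (simp add: power2_eq_square mult_ac)
    from this[OF N] show ?thesis unfolding t c e .
  qed
qed

text \<open>Over \<open>0 <= k <= n\<close> the alternating sum of both binomials is
  \<open>cos6 n = 1\<close>. The end terms at \<open>k = 0\<close> and \<open>k = n\<close> are
  \<open>2\<close> and \<open>-1\<close>, the latter because \<open>n\<close> is odd, so nothing is
  left in between.\<close>

lemma sum_tcb_vprod_zero:
  assumes n: "odd n" "cos6 n = 1"
  shows "(\<Sum>k\<in>{1..<n}. tcb k * vprod (of_nat n ^ 2) k) = 0"
proof -
  obtain m where m: "n = Suc m" using n by (cases n) auto
  define c where "c k = (-1) ^ k * (int ((n + k) choose (2 * k)) + int ((n + k - 1) choose (2 * k)))" for k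
  have "(\<Sum>k\<le>n. c k) = alt_choose_sum n + alt_choose_sum m"
  proof -
    have "alt_choose_sum m = (\<Sum>k\<le>n. (-1) ^ k * int ((n + k - 1) choose (2 * k)))"
      using alt_choose_sum_extend[of m n] m by (simp del: sum.atMost_Suc)
    then show ?thesis
      unfolding alt_choose_sum_def[of n] by (simp only: c_def distrib_left sum.distrib)
  qed
  then have "(\<Sum>k\<le>n. c k) = 1"
    using alt_choose_sum_cos6[of m] n m by simp
  moreover have "(\<Sum>k\<le>n. c k) = c 0 + (\<Sum>k\<in>{1..<n}. c k) + c n"
  proof -
    have "{..n} = insert 0 (insert n {1..<n})" using m by auto
    then show ?thesis using m by (simp add: algebra_simps)
  qed
  moreover have "c 0 = 2" by (simp add: c_def)
  moreover have "c n = - 1"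
  proof -
    have "(n + n - 1) choose (2 * n) = 0" by (rule binomial_eq_0) (simp add: m)
    then show ?thesis using n by (simp add: c_def mult_2)
  qed
  ultimately have 0: "(\<Sum>k\<in>{1..<n}. c k) = 0" by simp
  have "tcb k * vprod (of_nat n ^ 2) k = - of_int (c k) / (2 * of_nat n ^ 2)" if "k \<in> {1..<n}" for k
  proof -
    have "k \<ge> 1" "k < n" using that by auto
    moreover from this have "(-1) ^ (k - 1) = - ((-1) ^ k :: rat)" by (cases k) auto
    ultimately show ?thesis by (simp add: tcb_vprod_square(1) c_def)
  qed
  then have "(\<Sum>k\<in>{1..<n}. tcb k * vprod (of_nat n ^ 2) k) = - of_int (\<Sum>k\<in>{1..<n}. c k) / (2 * of_nat n ^ 2)"
    by (simp add: sum_divide_distrib[symmetric] sum_negf)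
  then show ?thesis unfolding 0 by simp
qed

text \<open>At \<open>x = n^2\<close> the factorials of \<open>vprod\<close> cancel those of the
  weight with index \<open>n - 1\<close>, except for \<open>n * (n - k)\<close>; this is what makes
  the Apery sum harmonic.\<close>

lemma apery_weight_vprod_square:
  assumes n: "odd n" and k: "k \<in> {1..<n}"
  shows "(-1) ^ (n - 1 + k) * apery_weight (n - 1) k * vprod (of_nat n ^ 2) k = - (1 / of_nat (n - k)) / of_nat n"
proof -
  obtain d where d: "n = Suc (k + d)" using k less_iff_Suc_add by auto
  obtain a where a: "k = Suc a" using k by (cases k) auto
  have s: "(-1) ^ (n - 1 + k) * (-1) ^ (k - 1) = (-1 :: rat)"
  proof -
    have "odd (n - 1 + k + (k - 1))" using n a d by simp
    then show ?thesis by (simp only: power_add[symmetric]) simp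
  qed
  define F where "F = (fact (n + k - 1) :: rat)"
  have F: "F \<noteq> 0" by (simp add: F_def)
  have w: "apery_weight (n - 1) k = fact a ^ 2 * fact d / F"
    by (simp add: apery_weight_def F_def a d)
  have v: "vprod (of_nat n ^ 2) k = (-1) ^ (k - 1) * F / (fact a ^ 2 * (of_nat (n - k) * fact d) * of_nat n)"
    using k by (simp add: vprod_square F_def) (simp add: a d)
  have "(-1) ^ (n - 1 + k) * apery_weight (n - 1) k * vprod (of_nat n ^ 2) k
    = ((-1) ^ (n - 1 + k) * (-1) ^ (k - 1)) * (1 / of_nat (n - k) / of_nat n)"
    unfolding w v using F k by (simp add: divide_simps)
  then show ?thesis unfolding s by simp
qed

lemma apery_sum_vprod_square:
  assumes n: "odd n"
  shows "apery_sum (vprod (of_nat n ^ 2)) (n - 1) = - (\<Sum>k\<in>{1..<n}. 1 / of_nat k) / of_nat n"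
proof -
  have "apery_sum (vprod (of_nat n ^ 2)) (n - 1) = (\<Sum>k\<in>{1..<n}. - (1 / of_nat (n - k)) / of_nat n)"
    unfolding apery_sum_def using apery_weight_vprod_square[OF n] by (intro sum.cong) auto
  also have "\<dots> = (\<Sum>k\<in>{1..<n}. - (1 / of_nat k) / of_nat n)"
    by (rule sum.reindex_bij_witness[of _ "\<lambda>k. n - k" "\<lambda>k. n - k"]) auto
  finally show ?thesis by (simp add: sum_negf sum_divide_distrib)
qed

lemma botez_catalan: "(\<Sum>i=1..2 * n. (-1) ^ (i - 1) / of_nat i :: rat) = (\<Sum>i=1..n. 1 / of_nat (n + i))"
proof (induction n)
  case (Suc n)
  have "(\<Sum>i=1..Suc n. 1 / of_nat (Suc n + i) :: rat) = (\<Sum>i=2..Suc (Suc n). 1 / of_nat (n + i))"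
    by (rule sum.reindex_bij_witness[of _ "\<lambda>i. i - 1" Suc]) auto
  also have "\<dots> = (\<Sum>i=1..n. 1 / of_nat (n + i)) - 1 / of_nat (n + 1) + 1 / of_nat (2 * n + 1) + 1 / of_nat (2 * n + 2)"
  proof -
    have "(\<Sum>i=1..Suc (Suc n). 1 / of_nat (n + i) :: rat) = 1 / of_nat (n + 1) + (\<Sum>i=2..Suc (Suc n). 1 / of_nat (n + i))"
      by (subst sum.atLeast_Suc_atMost) (auto simp: numeral_2_eq_2)
    moreover have "(\<Sum>i=1..Suc (Suc n). 1 / of_nat (n + i) :: rat)
      = (\<Sum>i=1..n. 1 / of_nat (n + i)) + 1 / of_nat (2 * n + 1) + 1 / of_nat (2 * n + 2)"
      by (simp add: add.commute)
    ultimately show ?thesis by linarith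
  qed
  also have "\<dots> = (\<Sum>i=1..2 * Suc n. (-1) ^ (i - 1) / of_nat i)"
  proof -
    have "of_nat (2 * n + 2) = (2 * of_nat (n + 1) :: rat)" by simp
    then have "1 / of_nat (n + 1) = (2 * (1 / of_nat (2 * n + 2)) :: rat)"
      by (simp only:) (simp del: of_nat_add of_nat_Suc)
    moreover have "(\<Sum>i=1..2 * Suc n. (-1) ^ (i - 1) / of_nat i :: rat)
      = (\<Sum>i=1..2 * n. (-1) ^ (i - 1) / of_nat i) + 1 / of_nat (2 * n + 1) - 1 / of_nat (2 * n + 2)"
      by (simp add: add.commute)
    ultimately show ?thesis using Suc.IH by linarith
  qed
  finally show ?case ..
qed simp

text \<open>Cut the alternating harmonic sum up to \<open>2 n\<close> at \<open>i = n\<close>,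
  reflect the lower part by \<open>k -> n - k\<close> and shift the upper part by \<open>n\<close>.
  For odd \<open>n\<close> both acquire the sign \<open>(-1)^k\<close>, and the terms at
  \<open>n\<close> and \<open>2 n\<close> together give the last term of the Botez-Catalan
  sum.\<close>

lemma alternating_sum_odd:
  assumes n: "odd n"
  shows "(\<Sum>k\<in>{1..<n}. (-1) ^ k * (1 / of_nat (n - k) + 1 / of_nat (n + k)) :: rat) = (\<Sum>k\<in>{1..<n}. 1 / of_nat (n + k))"
proof -
  let ?f = "\<lambda>i. (-1) ^ (i - 1) / of_nat i :: rat"
  have n1: "n \<ge> 1" using n by (cases n) auto
  have "{1..2 * n} = insert n (insert (2 * n) ({1..<n} \<union> {n<..<2 * n}))" using n1 by auto
  then have 1: "(\<Sum>i=1..2 * n. ?f i) = ?f n + ?f (2 * n) + (\<Sum>i\<in>{1..<n}. ?f i) + (\<Sum>i\<in>{n<..<2 * n}. ?f i)"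
  proof -
    have "(\<Sum>i\<in>{1..<n} \<union> {n<..<2 * n}. ?f i) = (\<Sum>i\<in>{1..<n}. ?f i) + (\<Sum>i\<in>{n<..<2 * n}. ?f i)"
      by (rule sum.union_disjoint) auto
    then show ?thesis using n1 \<open>{1..2 * n} = _\<close> by simp
  qed
  have 2: "(\<Sum>i\<in>{n<..<2 * n}. ?f i) = (\<Sum>k\<in>{1..<n}. (-1) ^ k / of_nat (n + k))"
    by (rule sum.reindex_bij_witness[of _ "\<lambda>k. n + k" "\<lambda>i. i - n"])
       (use n in \<open>auto simp: minus_one_power_iff\<close>)
  have 3: "(\<Sum>i\<in>{1..<n}. ?f i) = (\<Sum>k\<in>{1..<n}. (-1) ^ k / of_nat (n - k))"
    by (rule sum.reindex_bij_witness[of _ "\<lambda>k. n - k" "\<lambda>k. n - k"])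
       (use n in \<open>auto simp: minus_one_power_iff\<close>)
  have 4: "?f n = 1 / of_nat n" "?f (2 * n) = - 1 / of_nat (2 * n)"
    using n n1 by (auto simp: minus_one_power_iff)
  have 5: "{1..n} = insert n {1..<n}" using n1 by auto
  have 6: "(\<Sum>i=1..n. 1 / of_nat (n + i) :: rat) = 1 / of_nat (2 * n) + (\<Sum>k\<in>{1..<n}. 1 / of_nat (n + k))"
    unfolding 5 by simp
  have "1 / of_nat n = (2 / of_nat (2 * n) :: rat)" by simp
  moreover have "(\<Sum>k\<in>{1..<n}. (-1) ^ k * (1 / of_nat (n - k) + 1 / of_nat (n + k)) :: rat)
    = (\<Sum>k\<in>{1..<n}. (-1) ^ k / of_nat (n - k)) + (\<Sum>k\<in>{1..<n}. (-1) ^ k / of_nat (n + k))"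
    by (simp add: distrib_left sum.distrib)
  ultimately show ?thesis using 1 2 3 4 6 botez_catalan[of n] by linarith
qed

text \<open>At \<open>x = n^2\<close> the quotient \<open>(3 k^2 + x) / (k^2 - x)\<close> is
  \<open>3 + 4 n^2 / (k^2 - n^2)\<close>. The part with \<open>3\<close> is annihilated by
  \<open>sum_tcb_vprod_zero\<close>, which isolates the sum over the poles.\<close>

lemma sum_tcb_vprod_pole:
  assumes n: "odd n" "cos6 n = 1"
  shows "(\<Sum>k\<in>{1..<n}. tcb k * vprod (of_nat n ^ 2) k / (of_nat k ^ 2 - of_nat n ^ 2)) =
    (\<Sum>k\<in>{1..<n}. 1 / of_nat k) / of_nat n ^ 3
      + (\<Sum>k\<in>{1..<n}. 1 / (of_nat k * (of_nat k ^ 2 - of_nat n ^ 2))) / (2 * of_nat n)"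
proof -
  define N h Y W where "N = (of_nat n :: rat)" and "h = (\<Sum>k\<in>{1..<n}. 1 / of_nat k :: rat)"
    and "Y = (\<Sum>k\<in>{1..<n}. 1 / (of_nat k * (of_nat k ^ 2 - of_nat n ^ 2)) :: rat)"
    and "W = (\<Sum>k\<in>{1..<n}. tcb k * vprod (of_nat n ^ 2) k / (of_nat k ^ 2 - of_nat n ^ 2))"
  have n1: "n \<ge> 1" using n by (cases n) auto
  then have N: "N \<noteq> 0" by (simp add: N_def)
  have nz: "of_nat k ^ 2 - of_nat n ^ 2 \<noteq> (0::rat)" if "k < n" for k
  proof -
    have "k ^ 2 < n ^ 2" using that by (simp add: power_strict_mono)
    then have "of_nat (k ^ 2) \<noteq> (of_nat (n ^ 2) :: rat)" by (simp only: of_nat_eq_iff)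
    then show ?thesis by simp
  qed
  have I: "{1..n - 1} = {1..<n}" using n1 by auto
  have a: "- h / N = (\<Sum>k\<in>{1..<n}. 2 * (-1) ^ (k - 1) / (of_nat k ^ 2 - N ^ 2))
     - (\<Sum>k\<in>{1..<n}. tcb k * vprod (N ^ 2) k * (3 * of_nat k ^ 2 + N ^ 2) / (of_nat k ^ 2 - N ^ 2))"
  proof -
    have "of_nat k ^ 2 \<noteq> (of_nat n ^ 2 :: rat)" if "1 \<le> k" "k \<le> n - 1" for k
      using nz[of k] that by simp
    from apery_sum_vprod[of "n - 1" "of_nat n ^ 2", OF this] show ?thesis
      unfolding apery_sum_vprod_square[OF n(1)] I h_def N_def .
  qed
  have b: "(\<Sum>k\<in>{1..<n}. tcb k * vprod (N ^ 2) k * (3 * of_nat k ^ 2 + N ^ 2) / (of_nat k ^ 2 - N ^ 2))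
      = 4 * N ^ 2 * W"
  proof -
    have "tcb k * vprod (N ^ 2) k * (3 * of_nat k ^ 2 + N ^ 2) / (of_nat k ^ 2 - N ^ 2)
       = 3 * (tcb k * vprod (N ^ 2) k) + 4 * N ^ 2 * (tcb k * vprod (N ^ 2) k / (of_nat k ^ 2 - N ^ 2))"
      if "k \<in> {1..<n}" for k
    proof -
      have "of_nat k ^ 2 - N ^ 2 \<noteq> 0" using that nz unfolding N_def by auto
      moreover have "tcb k * vprod (N ^ 2) k * (3 * of_nat k ^ 2 + N ^ 2)
         = 3 * (tcb k * vprod (N ^ 2) k) * (of_nat k ^ 2 - N ^ 2) + 4 * N ^ 2 * (tcb k * vprod (N ^ 2) k)"
        by (simp add: algebra_simps)
      ultimately show ?thesis by (simp add: add_divide_distrib)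
    qed
    then have "(\<Sum>k\<in>{1..<n}. tcb k * vprod (N ^ 2) k * (3 * of_nat k ^ 2 + N ^ 2) / (of_nat k ^ 2 - N ^ 2))
      = (\<Sum>k\<in>{1..<n}. 3 * (tcb k * vprod (N ^ 2) k) + 4 * N ^ 2 * (tcb k * vprod (N ^ 2) k / (of_nat k ^ 2 - N ^ 2)))"
      by (intro sum.cong) auto
    also have "\<dots> = 3 * (\<Sum>k\<in>{1..<n}. tcb k * vprod (N ^ 2) k) + 4 * N ^ 2 * W"
      unfolding W_def N_def[symmetric] by (simp only: sum.distrib sum_distrib_left)
    finally show ?thesis using sum_tcb_vprod_zero[OF n] by (simp add: N_def)
  qed
  have c: "N * (\<Sum>k\<in>{1..<n}. 2 * (-1) ^ (k - 1) / (of_nat k ^ 2 - N ^ 2)) = (\<Sum>k\<in>{1..<n}. 1 / (N + of_nat k))"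
  proof -
    have "N * (2 * (-1) ^ (k - 1) / (of_nat k ^ 2 - N ^ 2)) = (-1) ^ k * (1 / of_nat (n - k) + 1 / of_nat (n + k))"
      if k: "k \<in> {1..<n}" for k
    proof -
      have "of_nat (n - k) = N - of_nat k" "of_nat (n + k) = N + of_nat k" using k by (auto simp: N_def of_nat_diff)
      moreover have "N - of_nat k \<noteq> 0" "N + of_nat k \<noteq> 0" using k by (auto simp: N_def simp flip: of_nat_add)
      moreover have "of_nat k ^ 2 - N ^ 2 = - ((N - of_nat k) * (N + of_nat k))"
        by (simp add: algebra_simps power2_eq_square)
      moreover have "(-1) ^ k = - ((-1) ^ (k - 1) :: rat)" using k by (cases k) auto
      moreover have "N * (2 * s / (- (A * B))) = - s * (1 / A + 1 / B)"
        if "A \<noteq> 0" "B \<noteq> 0" "A + B = 2 * N" for A B s :: rat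
      proof -
        have "1 / A + 1 / B = (A + B) / (A * B)" using that(1,2) by (simp add: add_divide_distrib)
        then show ?thesis unfolding that(3) by simp
      qed
      from this[of "N - of_nat k" "N + of_nat k"] show ?thesis using calculation by simp
    qed
    then show ?thesis using alternating_sum_odd[OF n(1)]
      by (simp add: sum_distrib_left N_def)
  qed
  \<comment> \<open>\<open>1 / (n + k) - 1 / (n - k) = 2 k / (k^2 - n^2)\<close>, and writing
    \<open>k^2 = (k^2 - n^2) + n^2\<close> splits off \<open>2 / k\<close>.\<close>
  have d: "(\<Sum>k\<in>{1..<n}. 1 / (N + of_nat k)) = 3 * h + 2 * N ^ 2 * Y"
  proof -
    have "1 / (N + of_nat k) = 1 / of_nat (n - k) + 2 * (1 / of_nat k) + 2 * N ^ 2 * (1 / (of_nat k * (of_nat k ^ 2 - N ^ 2)))"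
      if k: "k \<in> {1..<n}" for k
    proof -
      have 1: "of_nat (n - k) = N - of_nat k" using k by (auto simp: N_def of_nat_diff)
      have 2: "N - of_nat k \<noteq> 0" "N + of_nat k \<noteq> 0" "of_nat k \<noteq> (0::rat)" using k by (auto simp: N_def simp flip: of_nat_add)
      have 3: "of_nat k ^ 2 - N ^ 2 = - ((N - of_nat k) * (N + of_nat k))"
        by (simp add: algebra_simps power2_eq_square)
      show ?thesis unfolding 1 3 using 2
        by (simp add: divide_simps) (simp add: algebra_simps power2_eq_square)
    qed
    then have "(\<Sum>k\<in>{1..<n}. 1 / (N + of_nat k)) = (\<Sum>k\<in>{1..<n}. 1 / of_nat (n - k) + 2 * (1 / of_nat k)
        + 2 * N ^ 2 * (1 / (of_nat k * (of_nat k ^ 2 - N ^ 2))))"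
      by (intro sum.cong) auto
    also have "\<dots> = (\<Sum>k\<in>{1..<n}. 1 / of_nat (n - k)) + 2 * h + 2 * N ^ 2 * Y"
      unfolding h_def Y_def N_def[symmetric] by (simp only: sum.distrib sum_distrib_left)
    also have "(\<Sum>k\<in>{1..<n}. 1 / of_nat (n - k)) = h"
      unfolding h_def by (rule sum.reindex_bij_witness[of _ "\<lambda>k. n - k" "\<lambda>k. n - k"]) auto
    finally show ?thesis by simp
  qed
  have "4 * N ^ 2 * W = (3 * h + 2 * N ^ 2 * Y) / N + h / N"
  proof -
    have "(\<Sum>k\<in>{1..<n}. 2 * (-1) ^ (k - 1) / (of_nat k ^ 2 - N ^ 2)) = (3 * h + 2 * N ^ 2 * Y) / N"
      using c d N by (simp add: field_simps)
    then show ?thesis using a b by simp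
  qed
  then have "W = h / N ^ 3 + Y / (2 * N)"
  proof -
    have "4 * N ^ 2 * W = 4 * N ^ 2 * (h / N ^ 3 + Y / (2 * N))"
      unfolding \<open>4 * N ^ 2 * W = _\<close> using N by (simp add: field_simps power2_eq_square power3_eq_cube)
    then show ?thesis using N by simp
  qed
  then show ?thesis unfolding W_def N_def h_def Y_def .
qed

section \<open>Complete symmetric functions and ballot numbers\<close>

text \<open>Unlike in \<open>esym\<close>, indices may repeat. For \<open>r = 1, 2\<close> this is
  what \<open>esym r (p - j)\<close> becomes modulo \<open>p\<close>, up to the sign
  \<open>(-1)^r\<close>.\<close>

fun hsym :: "nat \<Rightarrow> nat \<Rightarrow> rat" where
  "hsym 0 j = 1"
| "hsym (Suc r) j = (\<Sum>l=1..j. hsym r l / of_nat l ^ 2)"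

definition binom_ratio :: "nat \<Rightarrow> nat \<Rightarrow> rat" where
  "binom_ratio j i = of_nat ((2 * j) choose (j + i)) / of_nat ((2 * j) choose j)"

lemma binom_ratio_fact: "i \<le> j \<Longrightarrow> binom_ratio j i = fact j ^ 2 / (fact (j - i) * fact (j + i))"
proof -
  assume i: "i \<le> j"
  have "of_nat ((2 * j) choose (j + i)) = fact (2 * j) / (fact (j + i) * fact (2 * j - (j + i)) :: rat)"
    using i by (intro binomial_fact) simp
  moreover have "of_nat ((2 * j) choose j) = fact (2 * j) / (fact j * fact (2 * j - j) :: rat)"
    by (intro binomial_fact) simp
  moreover have "2 * j - (j + i) = j - i" "2 * j - j = j" using i by auto
  ultimately show ?thesis by (simp add: binom_ratio_def power2_eq_square mult.commute)
qed

lemma binom_ratio_diff: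
  assumes "1 \<le> i" "i \<le> Suc a"
  shows "binom_ratio (Suc a) i - binom_ratio a i = binom_ratio (Suc a) i * of_nat i ^ 2 / of_nat (Suc a) ^ 2"
proof (cases "i = Suc a")
  case True
  then show ?thesis by (simp add: binom_ratio_def binomial_eq_0 del: of_nat_Suc)
next
  case False
  then obtain d where d: "a = i + d" using assms by (metis le_Suc_ex le_SucE)
  define F where "F = (fact a ^ 2 / (fact d * fact (a + i)) :: rat)"
  define x y :: rat where "x = of_nat (Suc a)" and "y = of_nat i"
  have E: "of_nat (Suc d) = x - y" "of_nat (Suc (a + i)) = x + y" by (simp_all add: x_def y_def d)
  then have nz: "x - y \<noteq> 0" "x + y \<noteq> 0" "x \<noteq> 0"
    by (metis of_nat_neq_0, metis of_nat_neq_0, simp add: x_def del: of_nat_Suc)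
  have 1: "binom_ratio a i = F" using d by (subst binom_ratio_fact) (auto simp: F_def)
  have "binom_ratio (Suc a) i = fact (Suc a) ^ 2 / (fact (Suc d) * fact (Suc (a + i)))"
    using d by (subst binom_ratio_fact) (auto simp: Suc_diff_le simp del: fact_Suc)
  also have "\<dots> = x ^ 2 * F / ((x - y) * (x + y))"
    unfolding fact_Suc E x_def[symmetric] by (simp add: F_def power_mult_distrib mult_ac)
  finally have 2: "binom_ratio (Suc a) i = x ^ 2 * F / ((x - y) * (x + y))" .
  have "(x ^ 2 * F / ((x - y) * (x + y))) * (x - y) * (x + y) = x ^ 2 * F" using nz by simp
  then have "F = binom_ratio (Suc a) i * (x - y) * (x + y) / x ^ 2" using nz 2 by (simp add: field_simps)
  then have "binom_ratio (Suc a) i - F = binom_ratio (Suc a) i * y ^ 2 / x ^ 2"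
    using nz by (simp add: divide_simps) (simp add: algebra_simps power2_eq_square)
  then show ?thesis using 1 by (simp add: x_def y_def)
qed

text \<open>Telescopes by Pascal's rule; it provides the case \<open>r = 0\<close> of
  \<open>hsym_binom_ratio\<close>.\<close>

lemma alternating_binomial_half_sum: "(\<Sum>i=1..j. (-1) ^ (i - 1) * of_nat ((2 * j) choose (j + i)) :: rat) = of_nat ((2 * j - 1) choose j)"
  if j: "j > 0"
proof -
  define X :: "nat \<Rightarrow> rat" where "X i = (-1) ^ i * of_nat ((2 * j - 1) choose (j + i))" for i
  have "(\<Sum>i=1..m. (-1) ^ (i - 1) * of_nat ((2 * j) choose (j + i))) = X 0 - X m" for m
  proof (induction m)
    case (Suc m)
    obtain k where k: "2 * j = Suc k" using j by (cases "2 * j") auto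
    have "of_nat ((2 * j) choose (j + Suc m)) = (of_nat (k choose (j + m)) + of_nat (k choose (j + Suc m)) :: rat)"
      unfolding k by simp
    then show ?case using Suc k by (simp add: X_def algebra_simps)
  qed simp
  moreover have "X j = 0" using that by (simp add: X_def binomial_eq_0)
  ultimately show ?thesis by (simp add: X_def)
qed

text \<open>Partial fractions of the generating function, the product of
  \<open>1 / (1 - t / l^2)\<close> over \<open>l <= j\<close>, read off at \<open>t^r\<close>: the
  numerator over \<open>1 - t / i^2\<close> is \<open>2 * (-1)^(i - 1) * binom_ratio j i\<close>.
  The induction on \<open>r\<close> and \<open>j\<close> rests on
  \<open>binom_ratio_diff\<close>.\<close>

lemma hsym_binom_ratio:
  assumes "j > 0"
  shows "hsym r j = 2 * (\<Sum>i=1..j. (-1) ^ (i - 1) * binom_ratio j i / of_nat i ^ (2 * r))"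
  using assms
proof (induction r arbitrary: j)
  case 0
  obtain k where k: "2 * j = Suc k" "j = Suc (k - j)" "k - j = j - 1" using 0 by (cases "2 * j") auto
  have "(2 * j) choose j = 2 * ((2 * j - 1) choose j)"
  proof -
    have "(k choose (j - 1)) = (k choose j)" using k by (metis binomial_symmetric add_diff_cancel_left' diff_le_self le_add1 mult_2 plus_1_eq_Suc add_Suc_right diff_Suc_1)
    then show ?thesis using k by (metis binomial_Suc_Suc diff_Suc_1 mult_2)
  qed
  then have "of_nat ((2 * j) choose j) = (2 * of_nat ((2 * j - 1) choose j) :: rat)" by simp
  moreover have "of_nat ((2 * j) choose j) \<noteq> (0 :: rat)" by simp
  moreover have "(\<Sum>i=1..j. (-1) ^ (i - 1) * binom_ratio j i) = of_nat ((2 * j - 1) choose j) / of_nat ((2 * j) choose j)"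
    using alternating_binomial_half_sum[OF 0]
    by (simp add: binom_ratio_def sum_divide_distrib[symmetric])
  ultimately show ?case by simp
next
  case (Suc r)
  note IH = Suc.IH
  let ?T = "\<lambda>j. 2 * (\<Sum>i=1..j. (-1) ^ (i - 1) * binom_ratio j i / of_nat i ^ (2 * Suc r)) :: rat"
  have "hsym (Suc r) j = ?T j" for j
  proof (induction j)
    case (Suc a)
    have t0: "binom_ratio a (Suc a) = 0" by (simp add: binom_ratio_def binomial_eq_0)
    have "?T (Suc a) - ?T a = 2 * (\<Sum>i=1..Suc a. (-1) ^ (i - 1) * (binom_ratio (Suc a) i - binom_ratio a i) / of_nat i ^ (2 * Suc r))"
    proof -
      have "(\<Sum>i=1..a. (-1) ^ (i - 1) * binom_ratio a i / of_nat i ^ (2 * Suc r))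
        = (\<Sum>i=1..Suc a. (-1) ^ (i - 1) * binom_ratio a i / of_nat i ^ (2 * Suc r))"
        using t0 by simp
      then show ?thesis
        by (simp only: right_diff_distrib diff_divide_distrib sum_subtractf)
    qed
    also have "\<dots> = 2 * (\<Sum>i=1..Suc a. (-1) ^ (i - 1) * binom_ratio (Suc a) i / of_nat i ^ (2 * r) / of_nat (Suc a) ^ 2)"
    proof -
      have "(-1) ^ (i - 1) * (binom_ratio (Suc a) i - binom_ratio a i) / of_nat i ^ (2 * Suc r)
         = (-1) ^ (i - 1) * binom_ratio (Suc a) i / of_nat i ^ (2 * r) / of_nat (Suc a) ^ 2" if "i \<in> {1..Suc a}" for i
      proof -
        have 1: "(of_nat i :: rat) ^ (2 * Suc r) = of_nat i ^ 2 * of_nat i ^ (2 * r)" by (simp add: power2_eq_square)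
        have 2: "(of_nat i :: rat) ^ 2 \<noteq> 0" using that by simp
        have "s * (B * I / X) / (I * R) = s * B / R / X" if "I \<noteq> 0" for s B I X R :: rat
          using that by simp
        from this[OF 2] show ?thesis using that binom_ratio_diff[of i a] unfolding 1 by simp
      qed
      then show ?thesis by (intro arg_cong[where f = "(*) 2"] sum.cong refl)
    qed
    also have "\<dots> = hsym r (Suc a) / of_nat (Suc a) ^ 2"
      unfolding sum_divide_distrib[symmetric] using IH[of "Suc a"] by simp
    finally show ?case using Suc.IH by (simp del: of_nat_Suc)
  qed simp
  then show ?case .
qed

text \<open>The ballot numbers \<open>i / j * C(2 j, j + i)\<close>, see \<open>ballot_eq\<close>.
  The difference form shows integrality and yields the recurrence by Pascal's rule;
  \<open>2 * j - 1\<close> truncates at \<open>j = 0\<close>, hence the condition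
  \<open>j > 0\<close> in the lemmas.\<close>

definition ballot :: "nat \<Rightarrow> nat \<Rightarrow> int" where
  "ballot j i = int ((2 * j - 1) choose (j + i - 1)) - int ((2 * j - 1) choose (j + i))"

lemma ballot_eq:
  assumes "j > 0" shows "(of_int (ballot j i) :: rat) = of_nat i / of_nat j * of_nat ((2 * j) choose (j + i))"
proof -
  obtain k where k: "2 * j = Suc k" using assms by (cases "2 * j") auto
  obtain m where m: "j + i = Suc m" using assms by (cases "j + i") auto
  have "Suc m * (Suc k choose Suc m) = Suc k * (k choose m)" by (rule Suc_times_binomial)
  then have "of_nat (Suc m * (Suc k choose Suc m)) = (of_nat (Suc k * (k choose m)) :: rat)" by (simp only:)
  then have 1: "(of_nat j + of_nat i) * of_nat (Suc k choose Suc m) = (2 * of_nat j * of_nat (k choose m) :: rat)"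
    unfolding of_nat_mult k[symmetric] m[symmetric] by (simp del: binomial_Suc_Suc)
  have 2: "of_nat (Suc k choose Suc m) = (of_nat (k choose m) + of_nat (k choose Suc m) :: rat)" by simp
  define A B C j' i' :: rat where "A = of_nat (k choose m)" and "B = of_nat (k choose Suc m)" and "C = of_nat (Suc k choose Suc m)"
    and "j' = of_nat j" and "i' = of_nat i"
  have e: "(j' + i') * C = 2 * j' * A" "C = A + B" using 1 2 by (simp_all only: A_def B_def C_def j'_def i'_def)
  have "j' \<noteq> 0" using assms by (simp add: j'_def)
  have "j' * (A - B) = 2 * j' * A - j' * C" unfolding e(2) by (simp add: algebra_simps)
  then have "j' * (A - B) = i' * C" using e(1) by (simp add: algebra_simps)
  then have "A - B = i' / j' * C" using \<open>j' \<noteq> 0\<close> by (simp add: field_simps)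
  then show ?thesis
    unfolding ballot_def k m A_def B_def C_def i'_def j'_def by simp
qed

lemma ballot_rec:
  assumes "j > 0" "i > 0"
  shows "ballot (Suc j) i = ballot j (Suc i) + 2 * ballot j i + ballot j (i - 1)"
proof -
  obtain k where k: "2 * j = Suc k" using assms by (cases "2 * j") auto
  obtain m where m: "j + i = Suc (Suc m)" using assms by (cases j; cases i) auto
  have "Suc j + i = Suc (Suc (Suc m))" "j + Suc i = Suc (Suc (Suc m))" "j + (i - 1) = Suc m"
     "2 * Suc j = Suc (Suc (Suc k))"
    using k m assms by auto
  then show ?thesis unfolding ballot_def k m by simp
qed

lemma ballot_gt: "0 < j \<Longrightarrow> j < i \<Longrightarrow> ballot j i = 0"
  unfolding ballot_def by (simp add: binomial_eq_0)

lemma ballot_self: "j > 0 \<Longrightarrow> ballot j j = 1"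
  unfolding ballot_def by (simp add: mult_2 binomial_eq_0)

section \<open>Sums of powers and Bernoulli numbers\<close>

text \<open>Faulhaber's formula. With \<open>S\<close> the sum of the series
  \<open>exp (j X)\<close>, \<open>X * S\<close> equals the Bernoulli series times
  \<open>exp (n X) - 1\<close>; compare coefficients at \<open>X^(m + 1)\<close>.\<close>

lemma sum_of_powers:
  "(\<Sum>j<n. of_nat j ^ m) =
    (\<Sum>l\<le>m. of_nat (Suc m choose l) * bernoulli l * of_nat n ^ (Suc m - l)) / of_nat (Suc m)"
proof -
  define G :: "rat fps" where "G = Abs_fps (\<lambda>n. bernoulli n / fact n)"
  define S :: "rat fps" where "S = (\<Sum>j<n. fps_exp (of_nat j))"
  have S: "S * (fps_exp 1 - 1) = fps_exp (of_nat n) - 1"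
    unfolding S_def
  proof (induction n)
    case (Suc n)
    have "fps_exp (of_nat (Suc n)) = fps_exp (of_nat n) * fps_exp (1 :: rat)"
      by (simp add: fps_exp_add_mult[symmetric] add.commute)
    then show ?case using Suc by (simp add: algebra_simps)
  qed simp
  have "G * (fps_exp (of_nat n) - 1) = fps_X * S"
    unfolding S[symmetric] using bernoulli_generating_function_mult by (simp add: G_def mult_ac)
  then have "fps_nth (G * (fps_exp (of_nat n) - 1)) (Suc m) = fps_nth (fps_X * S) (Suc m)" by simp
  moreover have "fps_nth (fps_X * S) (Suc m) = (\<Sum>j<n. of_nat j ^ m) / fact m"
    by (simp add: S_def fps_sum_nth sum_divide_distrib)
  moreover have "fps_nth (G * (fps_exp (of_nat n) - 1)) (Suc m) =
      (\<Sum>l\<le>m. bernoulli l / fact l * (of_nat n ^ (Suc m - l) / fact (Suc m - l)))"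
  proof -
    have "fps_nth (G * (fps_exp (of_nat n) - 1)) (Suc m) =
      (\<Sum>l\<le>m. bernoulli l / fact l * fps_nth (fps_exp (of_nat n) - 1) (Suc m - l))"
    proof -
      have "fps_nth (fps_exp (of_nat n) - 1 :: rat fps) 0 = 0" by simp
      then show ?thesis
        unfolding fps_mult_nth atLeast0AtMost by (simp add: G_def del: fact_Suc fps_sub_nth)
    qed
    also have "\<dots> = (\<Sum>l\<le>m. bernoulli l / fact l * (of_nat n ^ (Suc m - l) / fact (Suc m - l)))"
      by (intro sum.cong refl) (auto simp del: fact_Suc)
    finally show ?thesis .
  qed
  ultimately have "(\<Sum>j<n. of_nat j ^ m) = fact m * (\<Sum>l\<le>m. bernoulli l / fact l * (of_nat n ^ (Suc m - l) / fact (Suc m - l)))"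
    by simp
  also have "\<dots> = (\<Sum>l\<le>m. of_nat (Suc m choose l) * bernoulli l * of_nat n ^ (Suc m - l)) / of_nat (Suc m)"
    unfolding sum_distrib_left sum_divide_distrib
  proof (rule sum.cong[OF refl])
    fix l assume "l \<in> {..m}"
    then have "of_nat (Suc m choose l) = (fact (Suc m) / (fact l * fact (Suc m - l)) :: rat)"
      by (intro binomial_fact) simp
    moreover have "fact (Suc m) = of_nat (Suc m) * (fact m :: rat)" by simp
    ultimately show "fact m * (bernoulli l / fact l * (of_nat n ^ (Suc m - l) / fact (Suc m - l)))
        = of_nat (Suc m choose l) * bernoulli l * of_nat n ^ (Suc m - l) / of_nat (Suc m)"
      by (simp add: mult_ac del: of_nat_Suc binomial_Suc_Suc fact_Suc)
  qed
  finally show ?thesis .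
qed

section \<open>Power sums over the residues, and double harmonic sums of weight five\<close>

context prime_adic
begin

text \<open>Faulhaber's formula at \<open>n = 1\<close> is the usual recursion for Bernoulli
  numbers, and it divides only by \<open>m + 1 < p\<close>.\<close>

lemma Zp_bernoulli: "m + 1 < p \<Longrightarrow> bernoulli m \<in> Zp"
proof (induction m rule: less_induct)
  case (less m)
  have "(\<Sum>l\<le>m. of_nat (Suc m choose l) * bernoulli l) = of_nat (Suc m) * (\<Sum>j<1. of_nat j ^ m)"
    unfolding sum_of_powers[of m 1, unfolded of_nat_1 power_one mult_1_right] by (simp del: of_nat_Suc binomial_Suc_Suc)
  then have "of_nat (Suc m) * bernoulli m = of_nat (Suc m) * 0 ^ m - (\<Sum>l<m. of_nat (Suc m choose l) * bernoulli l)"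
    by (simp add: lessThan_Suc_atMost[symmetric])
  then have "bernoulli m = (of_nat (Suc m) * 0 ^ m - (\<Sum>l<m. of_nat (Suc m choose l) * bernoulli l)) / of_nat (Suc m)"
    by (metis nonzero_mult_div_cancel_left of_nat_neq_0)
  also have "\<dots> \<in> Zp"
  proof (rule Zp_divide)
    show "1 / of_nat (Suc m) \<in> Zp" using less.prems by (intro Zp_inverse_less) auto
    show "of_nat (Suc m) * 0 ^ m - (\<Sum>l<m. of_nat (Suc m choose l) * bernoulli l) \<in> Zp"
      by (intro Zp_diff Zp_mult Zp_sum Zp_power Zp_of_nat Zp_0 less.IH) (use less.prems in auto)
  qed
  finally show ?case .
qed

lemma power_sum_split_0:
  assumes "m > 0" shows "(\<Sum>j<p. of_nat j ^ m :: rat) = (\<Sum>j\<in>{1..<p}. of_nat j ^ m)"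
proof -
  have "{..<p} = insert 0 {1..<p}" using p_pos by auto
  then show ?thesis using assms by simp
qed

text \<open>In Faulhaber's formula at \<open>n = p\<close> every term except \<open>l = m\<close>
  carries at least \<open>p^2\<close>.\<close>

lemma power_sum_bernoulli:
  assumes "0 < m" "m + 1 < p"
  shows "pc 2 (\<Sum>j\<in>{1..<p}. of_nat j ^ m) (P * bernoulli m)"
proof -
  define f where "f l = of_nat (Suc m choose l) * bernoulli l * P ^ (Suc m - l)" for l
  have "(\<Sum>j\<in>{1..<p}. of_nat j ^ m) = (\<Sum>l\<le>m. f l) / of_nat (Suc m)"
    unfolding f_def sum_of_powers[of m p, symmetric] power_sum_split_0[OF assms(1)] ..
  also have "(\<Sum>l\<le>m. f l) = (\<Sum>l<m. f l) + of_nat (Suc m) * (P * bernoulli m)"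
    by (simp add: lessThan_Suc_atMost[symmetric] f_def mult_ac del: of_nat_Suc)
  also have "\<dots> / of_nat (Suc m) = (\<Sum>l<m. f l / of_nat (Suc m)) + P * bernoulli m"
    by (simp add: add_divide_distrib sum_divide_distrib del: of_nat_Suc)
  also have "pc 2 \<dots> ((\<Sum>l<m. 0) + P * bernoulli m)"
  proof (intro pc_add pc_sum pc_refl)
    fix l assume l: "l \<in> {..<m}"
    have z: "of_nat (Suc m choose l) * bernoulli l * P ^ (m - 1 - l) / of_nat (Suc m) \<in> Zp"
      using assms l by (intro Zp_divide_less Zp_mult Zp_power Zp_of_nat Zp_bernoulli) auto
    have "Suc m - l = 2 + (m - 1 - l)" using l by auto
    then have "f l / of_nat (Suc m) = P ^ 2 * (of_nat (Suc m choose l) * bernoulli l * P ^ (m - 1 - l) / of_nat (Suc m))"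
      unfolding f_def by (simp only: power_add) (simp add: mult_ac)
    then show "pc 2 (f l / of_nat (Suc m)) 0" using pc_multiple[OF z] by metis
  qed
  finally show ?thesis by simp
qed

lemma fermat: "0 < j \<Longrightarrow> j < p \<Longrightarrow> pc 1 (of_nat j ^ (p - 1)) 1"
proof -
  assume "0 < j" "j < p"
  then have "\<not> p dvd j" by (auto dest: dvd_imp_le)
  then have "[j ^ (p - 1) = 1] (mod p)" by (rule fermat_theorem[OF prime_p])
  then have "[int (j ^ (p - 1)) = int 1] (mod int p)" by (simp only: cong_int_iff)
  then have "int p ^ 1 dvd int (j ^ (p - 1)) - 1" by (simp add: cong_iff_dvd_diff)
  from pc_of_int[OF this] show ?thesis by simp
qed

lemma power_inverse_cong:
  assumes "0 < j" "j < p" "s \<le> p - 1"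
  shows "pc 1 (1 / of_nat j ^ s) (of_nat j ^ (p - 1 - s))"
proof -
  have "1 / of_nat j ^ s \<in> Zp"
    using assms by (intro Zp_divide_power_less Zp_1)
  from pc_mult_left[OF this fermat[OF assms(1,2)]]
  have "pc 1 (1 / of_nat j ^ s * of_nat j ^ (p - 1)) (1 / of_nat j ^ s)" by simp
  moreover have "of_nat j ^ (p - 1) = (of_nat j ^ s * of_nat j ^ (p - 1 - s) :: rat)"
    using assms by (simp flip: power_add)
  ultimately show ?thesis using assms by (auto intro: pc_sym)
qed

lemma power_sum_zero:
  assumes "0 < e" "e < 2 * (p - 1)" "e \<noteq> p - 1"
  shows "pc 1 (\<Sum>j\<in>{1..<p}. of_nat j ^ e) 0"
proof -
  have small: "pc 1 (\<Sum>j\<in>{1..<p}. of_nat j ^ m) 0" if "0 < m" "m < p - 1" for m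
  proof -
    have "pc 1 (\<Sum>j\<in>{1..<p}. of_nat j ^ m) (P * bernoulli m)"
      by (rule pc_mono[OF power_sum_bernoulli]) (use that in auto)
    also have "pc 1 \<dots> 0" using that by (intro pc_multiple_1 Zp_bernoulli) auto
    finally show ?thesis .
  qed
  show ?thesis
  proof (cases "e < p - 1")
    case False
    then obtain d where d: "e = p - 1 + d" by (metis le_Suc_ex not_less)
    have "pc 1 (\<Sum>j\<in>{1..<p}. of_nat j ^ e) (\<Sum>j\<in>{1..<p}. 1 * of_nat j ^ d)"
      unfolding d power_add by (intro pc_sum pc_mult_right fermat) auto
    also have "pc 1 \<dots> 0" using small[of d] d assms by simp
    finally show ?thesis .
  qed (use small assms in auto)
qed

lemma power_sum_fermat: "pc 1 (\<Sum>j\<in>{1..<p}. of_nat j ^ (p - 1)) (- 1)"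
proof -
  have "pc 1 (\<Sum>j\<in>{1..<p}. of_nat j ^ (p - 1)) (\<Sum>j\<in>{1..<p}. 1)"
    by (intro pc_sum fermat) auto
  also have "(\<Sum>j\<in>{1..<p}. 1 :: rat) = P * 1 + (- 1)"
    using p_pos by (simp add: of_nat_diff)
  also have "pc 1 \<dots> (0 + (- 1))" by (intro pc_add pc_multiple_1) auto
  finally show ?thesis by simp
qed

definition hpow :: "nat \<Rightarrow> rat" where
  "hpow s = (\<Sum>j\<in>{1..<p}. 1 / of_nat j ^ s)"

lemma hpow_zero:
  assumes "0 < s" "s < p - 1" shows "pc 1 (hpow s) 0"
proof -
  have "pc 1 (hpow s) (\<Sum>j\<in>{1..<p}. of_nat j ^ (p - 1 - s))"
    unfolding hpow_def using assms by (intro pc_sum power_inverse_cong) auto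
  also have "pc 1 \<dots> 0" using assms by (intro power_sum_zero) auto
  finally show ?thesis .
qed

text \<open>Fermat replaces inverse powers by positive ones and Faulhaber turns the inner sum into
  powers of \<open>j\<close>. The total exponent is \<open>2 * p - 6 - l\<close>; the outer sum
  vanishes unless this equals \<open>p - 1\<close>, that is \<open>l = p - 5\<close>, where it is
  \<open>-1\<close>.\<close>

lemma double_power_sum:
  assumes s: "2 \<le> s" "s \<le> 4" and p: "p > 5"
  shows "pc 1 (\<Sum>j\<in>{1..<p}. (\<Sum>i\<in>{1..<j}. 1 / of_nat i ^ s) / of_nat j ^ (5 - s))
    (- (of_nat ((p - s) choose (5 - s)) / of_nat (p - s) * bernoulli (p - 5)))"
proof -
  define m where "m = p - 1 - s"
  define C where "C l = of_nat (Suc m choose l) * bernoulli l / of_nat (Suc m)" for l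
  have m: "Suc m = p - s" "m > 0" "p - 5 \<le> m" using s p by (auto simp: m_def)
  have C: "C l \<in> Zp" if "l \<le> m" for l
    unfolding C_def using that s p m by (intro Zp_divide_less Zp_mult Zp_of_nat Zp_bernoulli) auto
  have "pc 1 (\<Sum>j\<in>{1..<p}. (\<Sum>i\<in>{1..<j}. 1 / of_nat i ^ s) / of_nat j ^ (5 - s))
     (\<Sum>j\<in>{1..<p}. (\<Sum>i\<in>{1..<j}. of_nat i ^ m) * of_nat j ^ (p - 1 - (5 - s)))"
  proof (intro pc_sum)
    fix j assume j: "j \<in> {1..<p}"
    have "pc 1 ((\<Sum>i\<in>{1..<j}. 1 / of_nat i ^ s) * (1 / of_nat j ^ (5 - s)))
      ((\<Sum>i\<in>{1..<j}. of_nat i ^ m) * of_nat j ^ (p - 1 - (5 - s)))"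
    proof (intro pc_mult)
      show "pc 1 (\<Sum>i\<in>{1..<j}. 1 / of_nat i ^ s) (\<Sum>i\<in>{1..<j}. of_nat i ^ m)"
        unfolding m_def using j s p by (intro pc_sum power_inverse_cong) auto
      show "pc 1 (1 / of_nat j ^ (5 - s)) (of_nat j ^ (p - 1 - (5 - s)))"
        using j s p by (intro power_inverse_cong) auto
      show "(\<Sum>i\<in>{1..<j}. 1 / of_nat i ^ s) \<in> Zp"
        using j by (intro Zp_sum Zp_divide_power_less) auto
      show "of_nat j ^ (p - 1 - (5 - s)) \<in> Zp" by (intro Zp_power) auto
    qed
    then show "pc 1 ((\<Sum>i\<in>{1..<j}. 1 / of_nat i ^ s) / of_nat j ^ (5 - s))
      ((\<Sum>i\<in>{1..<j}. of_nat i ^ m) * of_nat j ^ (p - 1 - (5 - s)))" by simp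
  qed
  also have "(\<Sum>j\<in>{1..<p}. (\<Sum>i\<in>{1..<j}. of_nat i ^ m) * of_nat j ^ (p - 1 - (5 - s)))
    = (\<Sum>j\<in>{1..<p}. \<Sum>l\<le>m. C l * of_nat j ^ (2 * p - 6 - l))"
  proof (intro sum.cong refl)
    fix j assume j: "j \<in> {1..<p}"
    have "{..<j} = insert 0 {1..<j}" using j by auto
    then have "(\<Sum>i\<in>{1..<j}. of_nat i ^ m :: rat) = (\<Sum>i<j. of_nat i ^ m)" using m by simp
    also have "\<dots> * of_nat j ^ (p - 1 - (5 - s)) = (\<Sum>l\<le>m. C l * (of_nat j ^ (Suc m - l) * of_nat j ^ (p - 1 - (5 - s))))"
      unfolding sum_of_powers sum_divide_distrib sum_distrib_right C_def by (intro sum.cong) auto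
    also have "\<dots> = (\<Sum>l\<le>m. C l * of_nat j ^ (2 * p - 6 - l))"
    proof (intro sum.cong refl)
      fix l assume "l \<in> {..m}"
      then have "Suc m - l + (p - 1 - (5 - s)) = 2 * p - 6 - l" using s p by (auto simp: m_def)
      then show "C l * (of_nat j ^ (Suc m - l) * of_nat j ^ (p - 1 - (5 - s))) = C l * of_nat j ^ (2 * p - 6 - l)"
        by (simp flip: power_add)
    qed
    finally show "(\<Sum>i\<in>{1..<j}. of_nat i ^ m) * of_nat j ^ (p - 1 - (5 - s)) = (\<Sum>l\<le>m. C l * of_nat j ^ (2 * p - 6 - l))" .
  qed
  also have "\<dots> = (\<Sum>l\<le>m. C l * (\<Sum>j\<in>{1..<p}. of_nat j ^ (2 * p - 6 - l)))"
    by (subst sum.swap) (simp add: sum_distrib_left)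
  also have "pc 1 \<dots> (\<Sum>l\<le>m. C l * (if l = p - 5 then - 1 else 0))"
  proof (intro pc_sum pc_mult_left)
    fix l assume l: "l \<in> {..m}"
    show "C l \<in> Zp" using C l by simp
    show "pc 1 (\<Sum>j\<in>{1..<p}. of_nat j ^ (2 * p - 6 - l)) (if l = p - 5 then - 1 else 0)"
    proof (cases "l = p - 5")
      case True
      then have "2 * p - 6 - l = p - 1" using p by auto
      then show ?thesis using True power_sum_fermat by simp
    next
      case False
      then have "pc 1 (\<Sum>j\<in>{1..<p}. of_nat j ^ (2 * p - 6 - l)) 0"
        using l s p by (intro power_sum_zero) (auto simp: m_def)
      then show ?thesis using False by simp
    qed
  qed
  also have "(\<Sum>l\<le>m. C l * (if l = p - 5 then - 1 else 0)) = (\<Sum>l\<le>m. if l = p - 5 then - C (p - 5) else 0)"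
    by (intro sum.cong) auto
  also have "\<dots> = - C (p - 5)"
    using m(3) by simp
  also have "\<dots> = - (of_nat ((p - s) choose (5 - s)) / of_nat (p - s) * bernoulli (p - 5))"
  proof -
    have "(p - s) choose (p - 5) = (p - s) choose (5 - s)"
      using s p binomial_symmetric[of "p - 5" "p - s"] by (simp add: m)
    then show ?thesis unfolding C_def m by simp
  qed
  finally show ?thesis .
qed

end

section \<open>Voronoi's congruence\<close>

context prime_adic
begin

lemma pc_power_first_order:
  assumes "r \<in> Zp" "u \<in> Zp"
  shows "pc 2 ((r + P * u) ^ n) (r ^ n + P * u * (of_nat n * r ^ (n - 1)))"
proof -
  have "\<exists>z\<in>Zp. (r + P * u) ^ n = r ^ n + P * u * (of_nat n * r ^ (n - 1)) + P ^ 2 * z"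
  proof (induction n)
    case (Suc n)
    then obtain z where z: "z \<in> Zp" "(r + P * u) ^ n = r ^ n + P * u * (of_nat n * r ^ (n - 1)) + P ^ 2 * z" by blast
    have d: "r * (of_nat n * r ^ (n - 1)) = of_nat n * r ^ n" by (cases n) auto
    have "(r + P * u) * (R + P * u * d + P ^ 2 * z) = r * R + P * u * (r * d + R) + P ^ 2 * (z * (r + P * u) + u ^ 2 * d)"
      for R d :: rat by (simp add: algebra_simps power2_eq_square)
    from this[of "r ^ n" "of_nat n * r ^ (n - 1)"] have "(r + P * u) ^ Suc n = r ^ Suc n + P * u * (of_nat (Suc n) * r ^ (Suc n - 1))
        + P ^ 2 * (z * (r + P * u) + u ^ 2 * (of_nat n * r ^ (n - 1)))"
      unfolding power_Suc z(2) d by (simp add: distrib_right add.commute)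
    moreover have "z * (r + P * u) + u ^ 2 * (of_nat n * r ^ (n - 1)) \<in> Zp"
      using z assms by (intro Zp_add Zp_mult Zp_power) auto
    ultimately show ?case by auto
  qed (auto intro: bexI[of _ 0])
  then show ?thesis by (auto intro: pcI)
qed

lemma bij_betw_mult_mod:
  assumes "0 < m" "m < p"
  shows "bij_betw (\<lambda>j. m * j mod p) {1..<p} {1..<p}"
proof -
  have nd: "\<not> p dvd m * j" if "0 < j" "j < p" for j
    using that assms prime_p by (auto simp: prime_dvd_mult_iff dest: dvd_imp_le)
  have "inj_on (\<lambda>j. m * j mod p) {1..<p}"
  proof (rule linorder_inj_onI)
    fix i j assume ij: "i < j" "i \<in> {1..<p}" "j \<in> {1..<p}"
    then have "\<not> p dvd m * (j - i)" by (intro nd) auto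
    then show "m * i mod p \<noteq> m * j mod p"
      using ij by (metis diff_mult_distrib2 less_imp_le mod_eq_dvd_iff_nat mult_le_mono2)
  qed auto
  moreover have "(\<lambda>j. m * j mod p) ` {1..<p} \<subseteq> {1..<p}"
    using nd p_pos by (auto simp: Suc_le_eq dvd_eq_mod_eq_0)
  ultimately show ?thesis
    by (simp add: bij_betw_def endo_inj_surj)
qed

text \<open>Voronoi's argument: write \<open>m j = p q + r\<close> and compare the sums of \<open>F\<close> over \<open>m j\<close> and over \<open>r\<close>.\<close>

lemma voronoi:
  fixes F G :: "nat \<Rightarrow> rat"
  assumes m: "0 < m" "m < p"
    and F: "\<And>r q. 0 < r \<Longrightarrow> r < p \<Longrightarrow> pc 2 (F (r + p * q)) (F r + P * of_nat q * G r)"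
    and G: "\<And>r q. 0 < r \<Longrightarrow> r < p \<Longrightarrow> pc 1 (G (r + p * q)) (G r)"
    and mult: "\<And>j. F (m * j) = F m * F j"
  shows "pc 2 ((F m - 1) * (\<Sum>j\<in>{1..<p}. F j)) (P * (\<Sum>j\<in>{1..<p}. of_nat (m * j div p) * G (m * j)))"
proof -
  let ?r = "\<lambda>j. m * j mod p" and ?q = "\<lambda>j. m * j div p"
  have r: "0 < ?r j" "?r j < p" if "j \<in> {1..<p}" for j
    using bij_betwE[OF bij_betw_mult_mod[OF m]] that by (force simp: Suc_le_eq)+
  have qr: "m * j = ?r j + p * ?q j" for j by simp
  have "F m * (\<Sum>j\<in>{1..<p}. F j) = (\<Sum>j\<in>{1..<p}. F (m * j))"
    by (simp add: mult sum_distrib_left)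
  also have "pc 2 \<dots> (\<Sum>j\<in>{1..<p}. F (?r j) + P * (of_nat (?q j) * G (m * j)))"
  proof (intro pc_sum)
    fix j assume j: "j \<in> {1..<p}"
    have "pc 2 (F (m * j)) (F (?r j) + P * of_nat (?q j) * G (?r j))"
      using F[OF r[OF j], of "?q j"] by (simp only: qr[symmetric])
    moreover have "pc 2 (F (?r j) + P * of_nat (?q j) * G (?r j)) (F (?r j) + P * (of_nat (?q j) * G (m * j)))"
    proof (intro pc_add pc_refl)
      have "pc 1 (of_nat (?q j) * G (?r j)) (of_nat (?q j) * G (m * j))"
        by (rule pc_mult_left[OF Zp_of_nat pc_sym]) (use G[OF r[OF j], of "?q j"] in \<open>simp only: qr[symmetric]\<close>)
      from pc_scale[OF this, of 1] show "pc 2 (P * of_nat (?q j) * G (?r j)) (P * (of_nat (?q j) * G (m * j)))"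
        by (simp add: mult.assoc numeral_2_eq_2)
    qed
    ultimately show "pc 2 (F (m * j)) (F (?r j) + P * (of_nat (?q j) * G (m * j)))"
      by (rule pc_trans)
  qed
  also have "(\<Sum>j\<in>{1..<p}. F (?r j) + P * (of_nat (?q j) * G (m * j)))
     = (\<Sum>j\<in>{1..<p}. F j) + P * (\<Sum>j\<in>{1..<p}. of_nat (?q j) * G (m * j))"
    using sum.reindex_bij_betw[OF bij_betw_mult_mod[OF m], of F]
    by (simp only: sum.distrib sum_distrib_left)
  finally have "pc 2 (F m * (\<Sum>j\<in>{1..<p}. F j)) \<dots>" .
  from pc_diff[OF this pc_refl[of 2 "\<Sum>j\<in>{1..<p}. F j"]] show ?thesis
    by (simp add: left_diff_distrib)
qed

section \<open>Floor sums and the harmonic sum of order four\<close>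

definition floor_sum :: "nat \<Rightarrow> rat" where
  "floor_sum m = (\<Sum>j\<in>{1..<p}. of_nat (m * j div p) / of_nat j ^ 5)"

text \<open>Voronoi's argument for \<open>F x = x^(p - 5)\<close>, whose sum is \<open>p * B\<close>
  modulo \<open>p^2\<close>. After cancelling \<open>p\<close>, Fermat turns
  \<open>m^(p - 5)\<close> into \<open>1 / m^4\<close>, and the derivative
  \<open>(p - 5) * x^(p - 6)\<close> into \<open>-5 / x^5\<close>.\<close>

lemma floor_sum_cong:
  assumes p: "p > 5" and m: "0 < m" "m < p"
  shows "pc 1 (floor_sum m) ((of_nat m ^ 5 - of_nat m) / 5 * bernoulli (p - 5))"
proof -
  define B where "B = bernoulli (p - 5)"
  have B: "B \<in> Zp" unfolding B_def using p by (intro Zp_bernoulli) auto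
  define n where "n = p - 5"
  have n: "n > 0" "n + 1 < p" "n = Suc (p - 6)" using p by (auto simp: n_def)
  let ?G = "\<lambda>x. of_nat n * of_nat x ^ (n - 1) :: rat"
  define S where "S = (\<Sum>j\<in>{1..<p}. of_nat j ^ n :: rat)"
  have S: "pc 2 S (P * B)" unfolding S_def B_def n_def[symmetric] by (rule power_sum_bernoulli[OF n(1,2)])
  have vor: "pc 2 ((of_nat m ^ n - 1) * S) (P * (\<Sum>j\<in>{1..<p}. of_nat (m * j div p) * ?G (m * j)))"
    unfolding S_def
  proof (rule voronoi[OF m])
    show "pc 2 (of_nat (r + p * q) ^ n) (of_nat r ^ n + P * of_nat q * ?G r)" for r q
      using pc_power_first_order[of "of_nat r" "of_nat q" n] by simp
    show "pc 1 (?G (r + p * q)) (?G r)" for r q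
    proof (intro pc_mult_left pc_power)
      show "pc 1 (of_nat (r + p * q)) (of_nat r)" by (rule pcI[of "of_nat q"]) auto
    qed (simp_all only: Zp_of_nat)
  qed (simp add: power_mult_distrib)
  have inv: "pc 1 (of_nat x ^ (n - 1)) (1 / of_nat x ^ 5)" if "0 < x" "x < p" for x
    using pc_sym[OF power_inverse_cong[OF that, of 5]] p by (simp add: n_def)
  have inv4: "pc 1 (of_nat m ^ n) (1 / of_nat m ^ 4)"
    using pc_sym[OF power_inverse_cong[OF m, of 4]] p by (simp add: n_def)
  have n5: "pc 1 (of_nat n) (- 5)"
    using p by (intro pcI[of 1]) (auto simp: n_def of_nat_diff)
  have "pc 1 (\<Sum>j\<in>{1..<p}. of_nat (m * j div p) * ?G (m * j)) (\<Sum>j\<in>{1..<p}. of_nat (m * j div p) * (- 5 * (1 / of_nat m ^ 5 * (1 / of_nat j ^ 5))))"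
  proof (intro pc_sum pc_mult_left Zp_of_nat)
    fix j assume j: "j \<in> {1..<p}"
    have "?G (m * j) = of_nat n * (of_nat m ^ (n - 1) * of_nat j ^ (n - 1))"
      by (simp add: power_mult_distrib)
    also have "pc 1 \<dots> (- 5 * (1 / of_nat m ^ 5 * (1 / of_nat j ^ 5)))"
      using j m by (intro pc_mult[OF n5] pc_mult inv Zp_mult Zp_power Zp_of_nat Zp_divide_power_less) auto
    finally show "pc 1 (?G (m * j)) (- 5 * (1 / of_nat m ^ 5 * (1 / of_nat j ^ 5)))" .
  qed
  also have "\<dots> = - 5 / of_nat m ^ 5 * floor_sum m"
    unfolding floor_sum_def sum_distrib_left by (intro sum.cong) auto
  finally have "pc 2 (P * (\<Sum>j\<in>{1..<p}. of_nat (m * j div p) * ?G (m * j))) (P * (- 5 / of_nat m ^ 5 * floor_sum m))"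
    by (rule pc_scale_1)
  with vor have "pc 2 ((of_nat m ^ n - 1) * S) (P * (- 5 / of_nat m ^ 5 * floor_sum m))" by (rule pc_trans)
  moreover have "pc 2 ((of_nat m ^ n - 1) * S) ((of_nat m ^ n - 1) * (P * B))"
    by (intro pc_mult_left S Zp_diff Zp_power Zp_of_nat Zp_1)
  ultimately have "pc 2 ((of_nat m ^ n - 1) * (P * B)) (P * (- 5 / of_nat m ^ 5 * floor_sum m))"
    by (rule pc_euclidean[rotated])
  then have "pc 2 (P * ((of_nat m ^ n - 1) * B)) (P * (- 5 / of_nat m ^ 5 * floor_sum m))"
    by (simp only: mult.left_commute)
  then have "pc 1 ((of_nat m ^ n - 1) * B) (- 5 / of_nat m ^ 5 * floor_sum m)" by (rule pc_unscale_1)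
  moreover have "pc 1 ((of_nat m ^ n - 1) * B) ((1 / of_nat m ^ 4 - 1) * B)"
    by (intro pc_mult_right pc_diff inv4 pc_refl B)
  ultimately have *: "pc 1 (- 5 / of_nat m ^ 5 * floor_sum m) ((1 / of_nat m ^ 4 - 1) * B)"
    by (rule pc_euclidean)
  have "- (of_nat m ^ 5) / of_nat 5 \<in> Zp" using p by (intro Zp_divide_less Zp_minus Zp_power) auto
  note 3 = pc_mult_left[OF this *]
  have 1: "- (of_nat m ^ 5) / of_nat 5 * (- 5 / of_nat m ^ 5 * floor_sum m) = floor_sum m" using m by simp
  have 2: "- (of_nat m ^ 5) / of_nat 5 * ((1 / of_nat m ^ 4 - 1) * B) = (of_nat m ^ 5 - of_nat m) / 5 * B"
    using m by (simp add: field_simps power_numeral_reduce)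
  show ?thesis using 3 unfolding 1 2 unfolding B_def .
qed

text \<open>The value is needed modulo \<open>p^2\<close>, whereas Fermat's replacement of
  \<open>1 / j^4\<close> by \<open>j^(p - 5)\<close> holds only modulo \<open>p\<close>. So
  Voronoi's argument is applied to \<open>F x = 1 / x^4\<close> itself with multiplier
  \<open>2\<close>; \<open>floor_sum 2\<close>, congruent to \<open>6 * B\<close>, enters with the
  factor \<open>-4 / 2^5\<close>.\<close>

lemma hpow4_cong:
  assumes p: "p > 5"
  shows "pc 2 (hpow 4) (4 / 5 * P * bernoulli (p - 5))"
proof -
  define B where "B = bernoulli (p - 5)"
  have B: "B \<in> Zp" unfolding B_def using p by (intro Zp_bernoulli) auto
  let ?F = "\<lambda>x. 1 / of_nat x ^ 4 :: rat" and ?G = "\<lambda>x. - 4 * (1 / of_nat x ^ 5) :: rat"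
  have unit: "1 / of_nat (r + p * q) \<in> Zp" if "0 < r" "r < p" for r q
    using that by (intro Zp_inverse_nat) (auto dest: dvd_imp_le simp: dvd_add_left_iff)
  have "pc 2 ((?F 2 - 1) * (\<Sum>j\<in>{1..<p}. ?F j)) (P * (\<Sum>j\<in>{1..<p}. of_nat (2 * j div p) * ?G (2 * j)))"
  proof (rule voronoi)
    fix r q assume r: "0 < r" "r < p"
    define x t y where "x = (of_nat r :: rat)" and "t = P * of_nat q" and "y = (of_nat (r + p * q) :: rat)"
    have x: "x \<noteq> 0" "y \<noteq> 0" and y: "y = x + t" using r p_pos by (auto simp: x_def y_def t_def simp flip: of_nat_mult of_nat_add)
    have ix: "1 / x \<in> Zp" "1 / y \<in> Zp" unfolding x_def y_def using unit[OF r] unit[OF r, of 0] by auto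
    \<comment> \<open>The exact remainder of the first-order expansion of
      \<open>1 / (x + t)^4\<close>.\<close>
    have "1 / y ^ 4 - (1 / x ^ 4 + t * (- 4 * (1 / x ^ 5))) = t ^ 2 * ((10 * x ^ 3 + 20 * x ^ 2 * t + 15 * x * t ^ 2 + 4 * t ^ 3) / x ^ 5 / y ^ 4)"
      using x by (simp add: divide_simps) (simp add: y algebra_simps power_numeral_reduce)
    also have "\<dots> = P ^ 2 * (of_nat q ^ 2 * ((10 * x ^ 3 + 20 * x ^ 2 * t + 15 * x * t ^ 2 + 4 * t ^ 3) / x ^ 5 / y ^ 4))"
      by (simp add: t_def power_mult_distrib)
    finally have e: "1 / y ^ 4 - (1 / x ^ 4 + t * (- 4 * (1 / x ^ 5))) = \<dots>" .
    have xt: "x \<in> Zp" "t \<in> Zp" unfolding x_def t_def by (auto intro: Zp_mult)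
    have "of_nat q ^ 2 * ((10 * x ^ 3 + 20 * x ^ 2 * t + 15 * x * t ^ 2 + 4 * t ^ 3) / x ^ 5 / y ^ 4) \<in> Zp"
      by (rule Zp_mult, rule Zp_power, simp, rule Zp_divide_power, rule Zp_divide_power)
         (use ix xt in \<open>auto intro!: Zp_add Zp_mult Zp_power\<close>)
    from pcI[OF this e] show "pc 2 (?F (r + p * q)) (?F r + P * of_nat q * ?G r)"
      unfolding x_def y_def t_def .
    show "pc 1 (?G (r + p * q)) (?G r)"
    proof (intro pc_mult_left)
      have "pc 1 y x" unfolding y_def x_def by (rule pcI[of "of_nat q"]) auto
      then have "pc 1 (1 / y) (1 / x)" using ix x by (intro pc_inverse)
      then have "pc 1 ((1 / y) ^ 5) ((1 / x) ^ 5)" using ix by (intro pc_power)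
      then show "pc 1 (1 / of_nat (r + p * q) ^ 5) (1 / of_nat r ^ 5)"
        unfolding y_def x_def by (simp add: power_divide)
    qed (auto intro: Zp_minus)
  qed (use p in \<open>auto simp: power_mult_distrib\<close>)
  also have "P * (\<Sum>j\<in>{1..<p}. of_nat (2 * j div p) * ?G (2 * j)) = P * (- 1 / 8 * floor_sum 2)"
    unfolding floor_sum_def sum_distrib_left
    by (intro sum.cong arg_cong[where f = "(*) P"]) (auto simp: power_mult_distrib)
  also have "pc 2 \<dots> (P * (- 1 / 8 * (6 * B)))"
  proof -
    have "pc 1 (floor_sum 2) (6 * B)" using floor_sum_cong[of 2] p by (simp add: B_def)
    moreover have "- 1 / 8 \<in> Zp"
      using Zp_minus[OF Zp_power[OF Zp_inverse_less[of 2], of 3]] p by (simp add: power_numeral_reduce)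
    ultimately have "pc 1 (- 1 / 8 * floor_sum 2) (- 1 / 8 * (6 * B))" by (intro pc_mult_left)
    then show ?thesis by (rule pc_scale_1)
  qed
  finally have *: "pc 2 (- 15 / 16 * hpow 4) (P * (- 3 / 4 * B))"
    unfolding hpow_def by simp
  have "- 16 / 15 \<in> Zp"
  proof -
    have "- 16 * (1 / of_nat 3) * (1 / of_nat 5) \<in> Zp"
      using p by (intro Zp_mult Zp_inverse_less Zp_minus Zp_numeral) auto
    then show ?thesis by simp
  qed
  from pc_mult_left[OF this *] show ?thesis by (simp add: B_def mult_ac)
qed

lemma reflect_sum: "(\<Sum>j\<in>{1..<p}. f (p - j)) = (\<Sum>j\<in>{1..<p}. f j)" for f :: "nat \<Rightarrow> rat"
  by (rule sum.reindex_bij_witness[of _ "\<lambda>k. p - k" "\<lambda>k. p - k"]) auto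

lemma reflect_inverse_power:
  assumes "0 < j" "j < p"
  shows "pc 1 (1 / of_nat (p - j) ^ s) ((- 1) ^ s / of_nat j ^ s)"
proof -
  have "pc 1 (1 / of_nat (p - j)) (- 1 / of_nat j)"
    using inverse_minus_p[OF assms] assms by (simp add: of_nat_diff)
  then have "pc 1 ((1 / of_nat (p - j)) ^ s) ((- 1 / of_nat j) ^ s)"
    by (rule pc_power) (use assms in \<open>auto intro!: Zp_divide_less Zp_inverse_less Zp_minus simp del: of_nat_diff\<close>)
  then show ?thesis by (simp only: power_divide power_one)
qed

section \<open>The six-periodic sum of inverse fifth powers\<close>

lemma p_mod_6:
  assumes "p > 5" shows "p mod 6 = 1 \<or> p mod 6 = 5"
proof -
  have "\<not> 2 dvd p" "\<not> 3 dvd p"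
    using prime_p assms by (auto simp: prime_nat_iff)
  then show ?thesis by presburger
qed

lemma less_6_cases:
  fixes n :: nat
  assumes "n < 6"
  obtains "n = 0" | "n = 1" | "n = 2" | "n = 3" | "n = 4" | "n = 5"
  using assms by linarith

lemma cos6_values: "cos6 2 = -1" "cos6 3 = -2" "cos6 4 = -1" "cos6 5 = 1" "cos6 6 = 2"
  by (simp_all add: eval_nat_numeral)

lemma cos6_reflect: "q \<le> 6 \<Longrightarrow> cos6 (6 - q) = cos6 q"
proof -
  assume "q \<le> 6"
  then consider "q = 6" | "q < 6" by linarith
  then show ?thesis
    by cases (auto elim!: less_6_cases simp: cos6_values)
qed

text \<open>Meant for \<open>p * q + r = 6 * a\<close> reduced modulo \<open>6\<close>: as
  \<open>p\<close> is \<open>1\<close> or \<open>-1\<close> there, \<open>r\<close> is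
  \<open>-q\<close> or \<open>q\<close>, and \<open>cos6\<close> is even.\<close>

lemma cos6_aux: "cos6 s = cos6 q" if "(d * q + s) mod 6 = 0" "q < 6" "s < 6" "d = 1 \<or> d = 5" for d q s :: nat
proof -
  have "6 dvd d * q + s" using that(1) by (simp only: dvd_eq_mod_eq_0)
  then obtain k where k: "d * q + s = 6 * k" by (rule dvdE)
  show ?thesis using that(4)
  proof
    assume "d = 1"
    then have "q + s = 6 * k" using k by simp
    moreover from this have "k = 0 \<or> k = 1" using that(2,3) by linarith
    ultimately have "(q = 0 \<and> s = 0) \<or> s = 6 - q" by auto
    then show ?thesis using cos6_reflect[of q] that(2) by auto
  next
    assume "d = 5"
    then have "6 * k + q = 6 * q + s" using k by simp
    then have "(6 * k + q) mod 6 = (6 * q + s) mod 6" by simp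
    then show ?thesis using that(2,3) by simp
  qed
qed

text \<open>For \<open>q = 6 * a div p\<close> the nested floors \<open>q div 2\<close> and
  \<open>q div 3\<close> are \<open>3 * a div p\<close> and \<open>2 * a div p\<close>, so the
  antisymmetric part of the weight becomes a combination of the floor sums for \<open>6\<close>,
  \<open>3\<close> and \<open>2\<close>.\<close>

lemma cos6_antisym: "of_int (cos6 q) - of_int (cos6 (5 - q)) = (of_nat q - 2 * of_nat (q div 2) - 3 * of_nat (q div 3) + 1 :: rat)" if "q < 6" for q
  using that by (auto elim!: less_6_cases simp: cos6_values)
text \<open>On \<open>r = 6 a mod p\<close> the six-periodic weight depends only on the quotient, since \<open>p\<close> is congruent to
  \<open>1\<close> or \<open>5\<close> modulo \<open>6\<close>.\<close>

lemma cos6_sum: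
  assumes p: "p > 5"
  shows "pc 1 (\<Sum>j\<in>{1..<p}. of_int (cos6 j) / of_nat j ^ 5) (5 / 54 * bernoulli (p - 5))"
proof -
  define B where "B = bernoulli (p - 5)"
  have B: "B \<in> Zp" unfolding B_def using p by (intro Zp_bernoulli) auto
  let ?q = "\<lambda>a. 6 * a div p" and ?r = "\<lambda>a. 6 * a mod p"
  have p6: "6 < p" using p prime_p by (cases "p = 6") (auto simp: prime_nat_iff dest: spec[of _ 2])
  have bij: "bij_betw ?r {1..<p} {1..<p}" using p6 by (intro bij_betw_mult_mod) auto
  have r: "0 < ?r j" "?r j < p" if "j \<in> {1..<p}" for j
    using bij_betwE[OF bij] that by (force simp: Suc_le_eq)+
  have q6: "?q a < 6" if "a < p" for a
    using that by (simp add: div_less_iff_less_mult p_pos)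
  have cq: "cos6 (?r a) = cos6 (?q a)" if a: "a \<in> {1..<p}" for a
  proof -
    have gen: "(x * y + z) mod 6 = ((x mod 6) * y + z mod 6) mod 6" for x y z :: nat
    proof -
      have "(x mod 6 * y + z) mod 6 = (x * y + z) mod 6" by (metis mod_add_left_eq mod_mult_left_eq)
      then show ?thesis by (simp add: mod_simps)
    qed
    have "(p * ?q a + ?r a) mod 6 = 0" by simp
    then have e: "((p mod 6) * ?q a + ?r a mod 6) mod 6 = 0" by (rule trans[OF gen[symmetric]])
    have "cos6 (?r a mod 6) = cos6 (?q a)"
    proof (rule cos6_aux[OF e _ _ p_mod_6[OF p]])
      show "?q a < 6" by (rule q6) (use a in simp)
    qed simp
    then show ?thesis using cos6_mod[of "?r a"] by simp
  qed
  define T where "T = (\<Sum>a\<in>{1..<p}. of_int (cos6 (?q a)) / of_nat a ^ 5 :: rat)"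
  have "(\<Sum>j\<in>{1..<p}. of_int (cos6 j) / of_nat j ^ 5) = (\<Sum>a\<in>{1..<p}. of_int (cos6 (?r a)) / of_nat (?r a) ^ 5)"
    by (rule sum.reindex_bij_betw[OF bij, symmetric])
  also have "pc 1 \<dots> (\<Sum>a\<in>{1..<p}. of_int (cos6 (?q a)) * (1 / of_nat (6 * a) ^ 5))"
  proof (intro pc_sum)
    fix a assume a: "a \<in> {1..<p}"
    have nz: "\<not> p dvd 6 * a" using r[OF a] by (auto simp: dvd_eq_mod_eq_0)
    have "6 * a = ?r a + p * ?q a" by simp
    then have "of_nat (6 * a) = (of_nat (?r a + p * ?q a) :: rat)" by metis
    then have "of_nat (?r a) - of_nat (6 * a) = P ^ 1 * (- of_nat (?q a))" by (simp only: of_nat_add of_nat_mult) simp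
    then have "pc 1 (of_nat (?r a)) (of_nat (6 * a))" by (rule pcI[rotated]) (auto intro: Zp_minus)
    moreover have inv: "1 / of_nat (?r a) \<in> Zp" "1 / of_nat (6 * a) \<in> Zp"
      by (rule Zp_inverse_less[OF r[OF a]], rule Zp_inverse_nat[OF nz])
    moreover have "of_nat (?r a) \<noteq> (0 :: rat)" "of_nat (6 * a) \<noteq> (0 :: rat)"
      using r(1)[OF a] a by (simp_all only: of_nat_eq_0_iff) auto
    ultimately have "pc 1 (1 / of_nat (?r a)) (1 / of_nat (6 * a))" by (rule pc_inverse)
    then have "pc 1 ((1 / of_nat (?r a)) ^ 5) ((1 / of_nat (6 * a)) ^ 5)"
      using inv by (rule pc_power)
    then have "pc 1 (of_int (cos6 (?q a)) * (1 / of_nat (?r a) ^ 5)) (of_int (cos6 (?q a)) * (1 / of_nat (6 * a) ^ 5))"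
      by (intro pc_mult_left Zp_of_int) (simp only: power_divide power_one)
    then show "pc 1 (of_int (cos6 (?r a)) / of_nat (?r a) ^ 5) (of_int (cos6 (?q a)) * (1 / of_nat (6 * a) ^ 5))"
      unfolding cq[OF a] by simp
  qed
  also have "\<dots> = 1 / 6 ^ 5 * T"
    unfolding T_def sum_distrib_left by (intro sum.cong) (auto simp: power_mult_distrib)
  finally have 1: "pc 1 (\<Sum>j\<in>{1..<p}. of_int (cos6 j) / of_nat j ^ 5) (1 / 6 ^ 5 * T)" .
  \<comment> \<open>Replacing \<open>a\<close> by \<open>p - a\<close> sends the quotient
    \<open>q\<close> to \<open>5 - q\<close> and, the exponent being odd, reverses the sign modulo
    \<open>p\<close>. Hence \<open>2 * T\<close> involves only the part of the weight antisymmetric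
    under \<open>q -> 5 - q\<close>.\<close>
  have qr: "?q (p - a) = 5 - ?q a" if a: "a \<in> {1..<p}" for a
  proof -
    have "p * ?q a + ?r a = 6 * a" by simp
    moreover have "?q a \<le> 5" using q6[of a] a by simp
    then have "p * ?q a \<le> p * 5" by simp
    ultimately have eq: "6 * (p - a) = (p - ?r a) + p * (5 - ?q a)"
      using r[OF a] a by (simp add: diff_mult_distrib2 algebra_simps)
    have "(s + p * t) div p = t" if "s < p" for s t using that by simp
    moreover have "p - ?r a < p" using r[OF a] by simp
    ultimately show ?thesis unfolding eq by blast
  qed
  have "T = (\<Sum>a\<in>{1..<p}. of_int (cos6 (?q (p - a))) / of_nat (p - a) ^ 5)"
    unfolding T_def by (rule reflect_sum[symmetric])
  also have "pc 1 \<dots> (\<Sum>a\<in>{1..<p}. of_int (cos6 (5 - ?q a)) * ((- 1) ^ 5 / of_nat a ^ 5))"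
  proof (intro pc_sum)
    fix a assume a: "a \<in> {1..<p}"
    have "pc 1 (of_int (cos6 (5 - ?q a)) * (1 / of_nat (p - a) ^ 5)) (of_int (cos6 (5 - ?q a)) * ((- 1) ^ 5 / of_nat a ^ 5))"
      using a by (intro pc_mult_left reflect_inverse_power Zp_of_int) auto
    then show "pc 1 (of_int (cos6 (?q (p - a))) / of_nat (p - a) ^ 5) (of_int (cos6 (5 - ?q a)) * ((- 1) ^ 5 / of_nat a ^ 5))"
      unfolding qr[OF a] by simp
  qed
  finally have "pc 1 (T + T) (T + (\<Sum>a\<in>{1..<p}. of_int (cos6 (5 - ?q a)) * ((- 1) ^ 5 / of_nat a ^ 5)))"
    by (intro pc_add pc_refl)
  also have "T + (\<Sum>a\<in>{1..<p}. of_int (cos6 (5 - ?q a)) * ((- 1) ^ 5 / of_nat a ^ 5))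
     = floor_sum 6 - 2 * floor_sum 3 - 3 * floor_sum 2 + hpow 5"
    unfolding T_def floor_sum_def hpow_def sum_distrib_left sum_subtractf[symmetric] sum.distrib[symmetric]
  proof (intro sum.cong refl)
    fix a assume a: "a \<in> {1..<p}"
    have q23: "3 * a div p = ?q a div 2" "2 * a div p = ?q a div 3"
    proof -
      have "?q a div 2 = (2 * (3 * a)) div (2 * p)" by (simp add: div_mult2_eq[symmetric] mult.commute)
      then show "3 * a div p = ?q a div 2" by simp
      have "?q a div 3 = (3 * (2 * a)) div (3 * p)" by (simp add: div_mult2_eq[symmetric] mult.commute)
      then show "2 * a div p = ?q a div 3" by simp
    qed
    from cos6_antisym[OF q6[of a]]
    have "of_int (cos6 (?q a)) - of_int (cos6 (5 - ?q a)) = (of_nat (?q a) - 2 * of_nat (?q a div 2) - 3 * of_nat (?q a div 3) + 1 :: rat)"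
      using a by auto
    then have "(of_int (cos6 (?q a)) - of_int (cos6 (5 - ?q a))) / of_nat a ^ 5 =
      (of_nat (?q a) - 2 * of_nat (?q a div 2) - 3 * of_nat (?q a div 3) + 1) / (of_nat a ^ 5 :: rat)" by simp
    then show "of_int (cos6 (?q a)) / of_nat a ^ 5 + of_int (cos6 (5 - ?q a)) * ((- 1) ^ 5 / of_nat a ^ 5) =
      of_nat (?q a) / of_nat a ^ 5 - 2 * (of_nat (3 * a div p) / of_nat a ^ 5)
        - 3 * (of_nat (2 * a div p) / of_nat a ^ 5) + 1 / (of_nat a ^ 5 :: rat)"
      unfolding q23 by (simp add: diff_divide_distrib add_divide_distrib)
  qed
  also have "pc 1 \<dots> ((6 ^ 5 - 6) / 5 * B - 2 * ((3 ^ 5 - 3) / 5 * B) - 3 * ((2 ^ 5 - 2) / 5 * B) + 0)"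
    using floor_sum_cong[OF p, of 6] floor_sum_cong[OF p, of 3] floor_sum_cong[OF p, of 2] p p6
    by (intro pc_add pc_diff pc_mult_left hpow_zero Zp_numeral) (auto simp: B_def)
  \<comment> \<open>\<open>1440 = 1554 - 2 * 48 - 3 * 6\<close>; half of it over \<open>6^5\<close>
    is \<open>5 / 54\<close>.\<close>
  also have "\<dots> = 1440 * B" by simp
  finally have "pc 1 (2 * T) (2 * (720 * B))" by simp
  then have "pc 1 T (720 * B)"
    by (rule pc_cancel) (use p in \<open>auto intro: Zp_inverse_numeral\<close>)
  moreover have "1 / 6 ^ 5 \<in> Zp"
    using Zp_power[OF Zp_inverse_less[of 6], of 5] p6 by (simp add: power_divide)
  ultimately have "pc 1 (1 / 6 ^ 5 * T) (1 / 6 ^ 5 * (720 * B))" by (intro pc_mult_left)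
  with 1 have "pc 1 (\<Sum>j\<in>{1..<p}. of_int (cos6 j) / of_nat j ^ 5) (1 / 6 ^ 5 * (720 * B))" by (rule pc_trans)
  then show ?thesis by (simp add: B_def)
qed

end

section \<open>Reflection\<close>

locale prime_gt_5 = prime_adic +
  assumes p_gt_5: "p > 5"
begin

lemma odd_p: "odd p"
  using prime_p p_gt_5 by (auto simp: prime_nat_iff dest: spec[of _ 2])

lemma cos6_p: "cos6 p = 1"
  using p_mod_6[OF p_gt_5] cos6_mod[of p] cos6_values by auto

lemma Zp_half: "1 / 2 \<in> Zp"
  using Zp_inverse_numeral[of "num.Bit0 num.One"] p_gt_5 by simp

lemma Zp_inverse_p_plus: "0 < k \<Longrightarrow> k < p \<Longrightarrow> 1 / of_nat (p + k) \<in> Zp"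
  by (rule Zp_inverse_nat) (auto dest: dvd_imp_le simp: dvd_add_right_iff)

lemma square_minus_P: "k < p \<Longrightarrow> of_nat k ^ 2 - P ^ 2 = - (of_nat (p - k) * of_nat (p + k))"
  by (simp add: of_nat_diff algebra_simps power2_eq_square)

lemma Zp_inverse_square_minus:
  assumes "0 < k" "k < p"
  shows "1 / (of_nat k ^ 2 - P ^ 2) \<in> Zp" "of_nat k ^ 2 - P ^ 2 \<noteq> 0"
proof -
  have "- (1 / of_nat (p - k) * (1 / of_nat (p + k))) \<in> Zp"
    using assms by (intro Zp_minus Zp_mult Zp_inverse_less Zp_inverse_p_plus) auto
  then show "1 / (of_nat k ^ 2 - P ^ 2) \<in> Zp" unfolding square_minus_P[OF assms(2)] by simp
  have "of_nat (p - k) \<noteq> (0 :: rat)" "of_nat (p + k) \<noteq> (0 :: rat)"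
    unfolding of_nat_eq_0_iff using assms by auto
  then show "of_nat k ^ 2 - P ^ 2 \<noteq> 0" unfolding square_minus_P[OF assms(2)] by simp
qed

lemma Zp_esym: "k \<le> p \<Longrightarrow> esym r k \<in> Zp"
proof (induction r arbitrary: k)
  case (Suc r)
  then show ?case unfolding esym.simps by (intro Zp_sum Zp_divide_power_less) auto
qed simp

text \<open>An exact equation instead of a congruence, because it will be multiplied by
  \<open>tcb k\<close>, whose denominator may contain \<open>p\<close>.\<close>

lemma vprod_expansion:
  assumes "k \<le> p"
  shows "\<exists>z\<in>Zp. vprod (P ^ 2) k = 1 - P ^ 2 * esym 1 k + P ^ 4 * z"
  using assms
proof (induction k)
  case 0
  then show ?case by (intro bexI[of _ 0]) (simp_all add: vprod_def)
next
  case (Suc k)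
  show ?case
  proof (cases "k = 0")
    case True
    then show ?thesis by (intro bexI[of _ 0]) (simp_all add: vprod_def)
  next
    case False
    obtain z where z: "z \<in> Zp" "vprod (P ^ 2) k = 1 - P ^ 2 * esym 1 k + P ^ 4 * z" using Suc by auto
    define s where "s = 1 / (of_nat k ^ 2 :: rat)"
    have s: "s \<in> Zp" unfolding s_def using False Suc.prems by (intro Zp_divide_power_less) auto
    have "esym 1 (Suc k) = esym 1 k + s" using False by (simp add: s_def)
    moreover have "vprod (P ^ 2) (Suc k) = vprod (P ^ 2) k * (1 - P ^ 2 * s)"
      using False by (simp add: vprod_Suc s_def)
    ultimately have "vprod (P ^ 2) (Suc k) = 1 - P ^ 2 * esym 1 (Suc k) + P ^ 4 * (z * (1 - P ^ 2 * s) + esym 1 k * s)"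
      unfolding z(2) by (simp add: algebra_simps flip: power_add)
    moreover have "esym 1 k \<in> Zp" using Suc.prems by (intro Zp_esym) auto
    then have "z * (1 - P ^ 2 * s) + esym 1 k * s \<in> Zp"
      using z s by (intro Zp_add Zp_mult Zp_diff Zp_power) auto
    ultimately show ?thesis by blast
  qed
qed

lemma vprod_unit:
  assumes "k \<le> p"
  shows "pc 2 (vprod (P ^ 2) k) 1" "vprod (P ^ 2) k \<in> Zp" "1 / vprod (P ^ 2) k \<in> Zp" "vprod (P ^ 2) k \<noteq> 0"
proof -
  obtain z where z: "z \<in> Zp" "vprod (P ^ 2) k = 1 - P ^ 2 * esym 1 k + P ^ 4 * z"
    using vprod_expansion[OF assms] by blast
  then have "vprod (P ^ 2) k - 1 = P ^ 2 * (P ^ 2 * z - esym 1 k)"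
    by (simp add: algebra_simps flip: power_add)
  moreover have "P ^ 2 * z - esym 1 k \<in> Zp"
    using z assms by (intro Zp_diff Zp_mult Zp_power Zp_of_nat Zp_esym) auto
  ultimately show "pc 2 (vprod (P ^ 2) k) 1" by (rule pcI[rotated])
  then show "vprod (P ^ 2) k \<in> Zp" by (rule pc_integral) simp
  have f: "1 / (1 - P ^ 2 / of_nat m ^ 2) \<in> Zp \<and> 1 - P ^ 2 / of_nat m ^ 2 \<noteq> 0" if "m \<in> {1..<k}" for m
  proof -
    have m: "0 < m" "m < p" using that assms by auto
    have "1 - P ^ 2 / of_nat m ^ 2 = (of_nat m ^ 2 - P ^ 2) / of_nat m ^ 2" using m by (simp add: diff_divide_distrib)
    moreover have "of_nat m ^ 2 * (1 / (of_nat m ^ 2 - P ^ 2)) \<in> Zp"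
      using m by (intro Zp_mult Zp_power Zp_of_nat Zp_inverse_square_minus)
    ultimately show ?thesis using m Zp_inverse_square_minus(2)[OF m] by simp
  qed
  have "1 / vprod (P ^ 2) k = (\<Prod>m\<in>{1..<k}. 1 / (1 - P ^ 2 / of_nat m ^ 2))"
    unfolding vprod_def by (simp add: prod_dividef)
  also have "\<dots> \<in> Zp" using f by (intro Zp_prod) auto
  finally show "1 / vprod (P ^ 2) k \<in> Zp" .
  show "vprod (P ^ 2) k \<noteq> 0" unfolding vprod_def using f by (auto simp: prod_zero_iff)
qed

text \<open>\<open>j!\<close> times the left binomial is the product of \<open>2 p - j - i\<close>
  over \<open>i < j\<close>. Modulo \<open>p\<close> this is \<open>(-1)^j\<close> times the product
  of \<open>j + i\<close>, which is \<open>(2 j - 1)! / (j - 1)!\<close>, half of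
  \<open>j! * C(2 j, j)\<close>.\<close>

lemma choose_reflect:
  assumes j: "0 < j" "j < p"
  shows "pc 1 (of_nat ((2 * p - j) choose j)) ((-1) ^ j * of_nat ((2 * j) choose j) / 2)"
proof -
  have fact_prod: "fact (a + n) = fact a * (\<Prod>i<n. of_nat (a + 1 + i) :: rat)" for a n
    by (induction n) (auto simp: algebra_simps)
  have 1: "of_nat ((2 * p - j) choose j) * fact j = (\<Prod>i<j. of_nat (2 * p - j - i) :: rat)"
    using j by (simp add: binomial_gbinomial gbinomial_prod_rev of_nat_diff atLeast0LessThan diff_diff_eq)
  have "pc 1 (\<Prod>i<j. of_nat (2 * p - j - i)) (\<Prod>i<j. - of_nat (j + i))"
  proof (intro pc_prod conjI)
    fix i assume "i \<in> {..<j}"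
    then have "of_nat (2 * p - j - i) - (- of_nat (j + i)) = P ^ 1 * 2" using j by (simp add: of_nat_diff)
    then show "pc 1 (of_nat (2 * p - j - i)) (- of_nat (j + i))" by (rule pcI[rotated]) simp
  qed (simp_all only: Zp_minus Zp_of_nat)
  also have "(\<Prod>i<j. - of_nat (j + i) :: rat) = (-1) ^ j * (\<Prod>i<j. of_nat (j + i))"
  proof -
    have "(\<Prod>i<n. - g i :: rat) = (-1) ^ n * (\<Prod>i<n. g i)" for g n by (induction n) auto
    then show ?thesis .
  qed
  also have "(\<Prod>i<j. of_nat (j + i) :: rat) = of_nat ((2 * j) choose j) / 2 * fact j"
  proof -
    obtain a where a: "j = Suc a" using j by (cases j) auto
    have "fact (a + j) = fact a * (\<Prod>i<j. of_nat (j + i) :: rat)"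
      using fact_prod[of a j] by (simp add: a)
    moreover have "of_nat ((2 * j) choose j) = fact (2 * j) / (fact j * fact (2 * j - j) :: rat)"
      by (rule binomial_fact) simp
    moreover have "fact (2 * j) = of_nat (2 * j) * (fact (2 * j - 1) :: rat)"
      by (rule fact_reduce) (use j in simp)
    moreover have "fact j = of_nat j * (fact a :: rat)" by (simp add: a)
    moreover have "2 * j - j = j" "2 * j - 1 = a + j" using a by auto
    ultimately have "of_nat ((2 * j) choose j) = 2 * of_nat j * (fact a * (\<Prod>i<j. of_nat (j + i))) / (fact j * (of_nat j * fact a) :: rat)"
      by simp
    then show ?thesis using j by simp
  qed
  finally have "pc 1 (fact j * of_nat ((2 * p - j) choose j)) (fact j * ((-1) ^ j * of_nat ((2 * j) choose j) / 2))"
    unfolding 1[symmetric] by (simp add: mult_ac)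
  moreover have "1 / fact j \<in> Zp"
  proof -
    have "\<not> p dvd fact j" using j prime_p by (simp add: prime_dvd_fact_iff)
    from Zp_inverse_nat[OF this] show ?thesis by simp
  qed
  ultimately show ?thesis by (rule pc_cancel) simp
qed

text \<open>For \<open>k = p - j\<close> the second form in \<open>tcb_vprod_square\<close> contains
  \<open>C(p + k, 2 k) = C(2 p - j, j)\<close>, and \<open>P\<close> cancels the one factor
  \<open>p\<close> below. Since \<open>vprod\<close> is a unit congruent to \<open>1\<close>,
  integrality and value both follow.\<close>

lemma tcb_reflect:
  assumes j: "0 < j" "j < p"
  shows "pc 1 (P * tcb (p - j)) (- (of_nat ((2 * j) choose j) / (2 * of_nat j)))"
    and "P * tcb (p - j) \<in> Zp"
proof -
  define k where "k = p - j"
  have k: "1 \<le> k" "k < p" "p + k = 2 * p - j" "2 * k = (2 * p - j) - j" using j by (auto simp: k_def)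
  have sym: "(p + k) choose (2 * k) = (2 * p - j) choose j"
    unfolding k using binomial_symmetric[of j "2 * p - j"] j by simp
  define s :: rat where "s = (-1) ^ (k - 1)"
  have s: "s * (-1) ^ j = 1"
  proof -
    have "k - 1 + j = p - 1" using j by (simp add: k_def)
    then have "s * (-1) ^ j = (-1) ^ (p - 1)" unfolding s_def by (simp flip: power_add)
    then show ?thesis using odd_p by simp
  qed
  have sZ: "s \<in> Zp" unfolding s_def by (intro Zp_power Zp_minus Zp_1)
  have e: "P * tcb k * vprod (P ^ 2) k = s * of_nat ((2 * p - j) choose j) * (1 / of_nat (p + k))"
    using tcb_vprod_square(2)[OF k(1,2)] p_pos unfolding sym s_def by (simp add: mult.assoc)
  have inv: "1 / of_nat (p + k) \<in> Zp" using k by (intro Zp_inverse_p_plus) auto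
  have nz: "of_nat (p + k) \<noteq> (0::rat)" "- of_nat j \<noteq> (0 :: rat)" 
    unfolding neg_equal_0_iff_equal of_nat_eq_0_iff using k j by auto
  have pk: "pc 1 (1 / of_nat (p + k)) (1 / (- of_nat j))"
  proof (rule pc_inverse)
    have "of_nat (p + k) - (- of_nat j) = P ^ 1 * 2" using j by (simp add: k_def of_nat_diff)
    then show "pc 1 (of_nat (p + k)) (- of_nat j)" by (rule pcI[rotated]) simp
    show "1 / - of_nat j \<in> Zp" using Zp_minus[OF Zp_inverse_less[OF j]] by simp
  qed (rule inv nz)+
  have v: "pc 1 (vprod (P ^ 2) k) 1" by (rule pc_mono[OF vprod_unit(1)]) (use k in auto)
  have "P * tcb k = (s * of_nat ((2 * p - j) choose j) * (1 / of_nat (p + k))) * (1 / vprod (P ^ 2) k)"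
    unfolding e[symmetric] using vprod_unit(4)[of k] k by simp
  also have "\<dots> \<in> Zp"
    using k by (intro Zp_mult sZ Zp_of_nat inv vprod_unit) auto
  finally have Z: "P * tcb k \<in> Zp" .
  then show "P * tcb (p - j) \<in> Zp" by (simp add: k_def)
  have "pc 1 (P * tcb k) (P * tcb k * vprod (P ^ 2) k)" using pc_sym[OF pc_mult_left[OF Z v]] by simp
  also have "P * tcb k * vprod (P ^ 2) k = s * of_nat ((2 * p - j) choose j) * (1 / of_nat (p + k))" by (rule e)
  also have "pc 1 \<dots> (s * ((-1) ^ j * of_nat ((2 * j) choose j) / 2) * (1 / (- of_nat j)))"
  proof (rule pc_mult[OF pc_mult_left[OF sZ choose_reflect[OF j]] pk])
    show "s * of_nat ((2 * p - j) choose j) \<in> Zp" by (intro Zp_mult sZ Zp_of_nat)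
    show "1 / - of_nat j \<in> Zp" using Zp_minus[OF Zp_inverse_less[OF j]] by simp
  qed
  also have "s * ((-1) ^ j * of_nat ((2 * j) choose j) / 2) * (1 / (- of_nat j)) = (s * (-1) ^ j) * (- (of_nat ((2 * j) choose j) / (2 * of_nat j)))"
    by simp
  finally show "pc 1 (P * tcb (p - j)) (- (of_nat ((2 * j) choose j) / (2 * of_nat j)))"
    unfolding s k_def by simp
qed

lemma Zp_P_tcb: "0 < k \<Longrightarrow> k < p \<Longrightarrow> P * tcb k \<in> Zp"
  using tcb_reflect(2)[of "p - k"] by simp

text \<open>The product of the weight with \<open>vprod\<close> is known exactly; dividing by this
  unit congruent to \<open>1\<close> leaves \<open>- 1 / (p - k)\<close>, that is
  \<open>1 / k\<close>.\<close>

lemma apery_weight_cong: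
  assumes k: "0 < k" "k < p"
  shows "pc 1 (P * ((-1) ^ (p - 1 + k) * apery_weight (p - 1) k)) (1 / of_nat k)"
proof -
  define X where "X = P * ((-1) ^ (p - 1 + k) * apery_weight (p - 1) k)"
  have "X * vprod (P ^ 2) k = - (1 / of_nat (p - k))"
  proof -
    have "X * vprod (P ^ 2) k = P * ((-1) ^ (p - 1 + k) * apery_weight (p - 1) k * vprod (P ^ 2) k)"
      unfolding X_def by (simp only: mult.assoc)
    also have "\<dots> = P * (- (1 / of_nat (p - k)) / P)"
      using apery_weight_vprod_square[OF odd_p, of k] k by simp
    finally show ?thesis using p_pos by simp
  qed
  then have X: "X = - (1 / of_nat (p - k)) * (1 / vprod (P ^ 2) k)"
    using vprod_unit(4)[of k] k by (simp add: field_simps)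
  have Zk: "1 / of_nat (p - k) \<in> Zp" using k by (intro Zp_inverse_less) auto
  have "pc 1 X (- (- 1 / of_nat k) * (1 / 1))"
    unfolding X
  proof (intro pc_mult pc_minus)
    show "pc 1 (1 / of_nat (p - k)) (- 1 / of_nat k)" using reflect_inverse_power[OF k, of 1] by simp
    show "pc 1 (1 / vprod (P ^ 2) k) (1 / 1)"
      using vprod_unit[of k] k by (intro pc_inverse pc_mono[OF vprod_unit(1)]) auto
    show "- (1 / of_nat (p - k)) \<in> Zp" by (rule Zp_minus[OF Zk])
  qed simp
  then show ?thesis unfolding X_def by simp
qed

section \<open>Reflection of the symmetric functions\<close>

lemma esym_p: "pc 1 (esym 1 p) 0"
  using hpow_zero[of 2] p_gt_5 by (simp add: hpow_def)

lemma esym_2: "2 * esym 2 k = esym 1 k ^ 2 - (\<Sum>m\<in>{1..<k}. 1 / of_nat m ^ 4)"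
proof (induction k)
  case (Suc k)
  show ?case
  proof (cases "k = 0")
    case False
    then have "esym 2 (Suc k) = esym 2 k + esym 1 k * (1 / of_nat k ^ 2)" "esym 1 (Suc k) = esym 1 k + 1 / of_nat k ^ 2"
      by (simp_all add: numeral_2_eq_2)
    moreover have "(\<Sum>m\<in>{1..<Suc k}. 1 / of_nat m ^ 4) = (\<Sum>m\<in>{1..<k}. 1 / of_nat m ^ 4) + (1 / of_nat k ^ 2 :: rat) ^ 2"
      using False by (simp add: power_divide)
    ultimately show ?thesis using Suc by (simp add: power2_sum algebra_simps)
  qed (simp add: numeral_2_eq_2)
qed (simp add: numeral_2_eq_2)

lemma esym_2_p: "pc 1 (esym 2 p) 0"
proof -
  have "2 * esym 2 p = esym 1 p * esym 1 p - hpow 4"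
    unfolding esym_2 by (simp add: hpow_def power2_eq_square)
  moreover have "pc 1 (esym 1 p * esym 1 p - hpow 4) (0 * 0 - 0)"
    using p_gt_5 by (intro pc_diff pc_mult esym_p hpow_zero Zp_esym) auto
  ultimately have "pc 1 (2 * esym 2 p) (2 * 0)" by simp
  then show ?thesis by (rule pc_cancel) (auto intro: Zp_half)
qed

lemma Zp_hsym: "j < p \<Longrightarrow> hsym r j \<in> Zp"
proof (induction r arbitrary: j)
  case (Suc r)
  then show ?case unfolding hsym.simps by (intro Zp_sum Zp_divide_power_less) auto
qed simp

lemma hsym_Suc: "hsym (Suc r) (Suc j) = hsym (Suc r) j + hsym r (Suc j) / of_nat (Suc j) ^ 2"
  by simp

lemma esym_reflect_step:
  assumes "Suc j < p"
  shows "esym (Suc r) (p - Suc j) = esym (Suc r) (p - j) - esym r (p - Suc j) * (1 / of_nat (p - Suc j) ^ 2)"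
proof -
  have "p - j = Suc (p - Suc j)" using assms by simp
  then show ?thesis using assms by simp
qed

lemma esym_1_reflect: "j < p \<Longrightarrow> pc 1 (esym 1 (p - j)) (- hsym 1 j)"
proof (induction j)
  case 0
  then show ?case using esym_p by simp
next
  case (Suc j)
  have "esym 1 (p - Suc j) = esym 1 (p - j) - 1 / of_nat (p - Suc j) ^ 2"
    using esym_reflect_step[of j 0] Suc.prems by simp
  also have "pc 1 \<dots> (- hsym 1 j - (- 1) ^ 2 / of_nat (Suc j) ^ 2)"
    using Suc by (intro pc_diff reflect_inverse_power) auto
  also have "\<dots> = - hsym 1 (Suc j)" by simp
  finally show ?case .
qed

text \<open>Descend from \<open>p\<close>, where both sides vanish. Lowering the argument removes
  the variable \<open>1 / (p - j - 1)^2\<close>, congruent to \<open>1 / (j + 1)^2\<close>; with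
  \<open>esym_1_reflect\<close> the resulting recursion is that of \<open>hsym\<close>.\<close>

lemma esym_2_reflect: "j < p \<Longrightarrow> pc 1 (esym 2 (p - j)) (hsym 2 j)"
proof (induction j)
  case 0
  then show ?case using esym_2_p by (simp add: numeral_2_eq_2)
next
  case (Suc j)
  have "esym 2 (p - Suc j) = esym 2 (p - j) - esym 1 (p - Suc j) * (1 / of_nat (p - Suc j) ^ 2)"
    using esym_reflect_step[of j 1] Suc.prems by (simp only: numeral_2_eq_2 One_nat_def)
  also have "pc 1 \<dots> (hsym 2 j - (- hsym 1 (Suc j)) * ((- 1) ^ 2 / of_nat (Suc j) ^ 2))"
    using Suc by (intro pc_diff pc_mult reflect_inverse_power esym_1_reflect Zp_esym Zp_divide_power_less Zp_power Zp_minus Zp_1) auto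
  also have "\<dots> = hsym 2 (Suc j)"
  proof -
    have "a - (- b) * ((- 1) ^ 2 / c ^ 2) = a + b / c ^ 2" for a b c :: rat by simp
    then show ?thesis using hsym_Suc[of 1 j] by (simp only: numeral_2_eq_2 One_nat_def)
  qed
  finally show ?case .
qed

end

section \<open>The congruence\<close>

context prime_gt_5
begin

abbreviation B :: rat where "B \<equiv> bernoulli (p - 5)"

lemma Zp_B: "B \<in> Zp"
  using p_gt_5 by (intro Zp_bernoulli) auto

lemma six_lt_p: "6 < p"
  using p_gt_5 odd_p by (cases "p = 6") auto

section \<open>Ballot sums and the value of \<open>delta\<close>\<close>

lemma choose_2p_minus_1: "m < p \<Longrightarrow> pc 1 (of_nat ((2 * p - 1) choose m)) ((-1) ^ m)"
proof (induction m)
  case (Suc m)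
  obtain n where n: "2 * p = Suc n" using p_pos by (cases "2 * p") auto
  have "Suc m * (Suc n choose Suc m) = Suc n * (n choose m)" by (rule Suc_times_binomial)
  then have "of_nat (Suc m) * of_nat (Suc n choose Suc m) = (2 * P * of_nat (n choose m) :: rat)"
    unfolding n[symmetric] of_nat_mult[symmetric] by (simp del: binomial_Suc_Suc of_nat_Suc)
  then have "of_nat (Suc n choose Suc m) = P * (2 * of_nat (n choose m) / of_nat (Suc m))"
    by (simp add: field_simps del: binomial_Suc_Suc of_nat_Suc)
  moreover have "pc 1 (P * (2 * of_nat (n choose m) / of_nat (Suc m))) 0"
    using Suc.prems by (intro pc_multiple_1 Zp_divide_less Zp_mult Zp_of_nat Zp_numeral) auto
  ultimately have "pc 1 (of_nat (Suc n choose Suc m) - of_nat (n choose m)) (0 - (-1) ^ m)"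
    using Suc n by (intro pc_diff) auto
  then show ?case using n by simp
qed simp

text \<open>By symmetry \<open>C(2 p - 1, p + r) = C(2 p - 1, p - 1 - r)\<close>, which is
  \<open>(-1)^r\<close> modulo \<open>p\<close> as \<open>p - 1\<close> is even; consecutive values
  have opposite signs, hence the factor \<open>2\<close>.\<close>

lemma ballot_p:
  assumes "0 < i" "i < p"
  shows "pc 1 (of_int (ballot p i)) (- 2 * (-1) ^ i)"
proof -
  have c: "pc 1 (of_nat ((2 * p - 1) choose (p + r))) ((-1) ^ r)" if "r < p" for r
  proof -
    have "(2 * p - 1) choose (p + r) = (2 * p - 1) choose (p - 1 - r)"
      using that binomial_symmetric[of "p + r" "2 * p - 1"] by (simp add: mult_2)
    moreover have "(-1) ^ (p - 1 - r) = ((-1) ^ r :: rat)"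
      using odd_p that by (auto simp: minus_one_power_iff)
    ultimately show ?thesis using choose_2p_minus_1[of "p - 1 - r"] p_pos by simp
  qed
  obtain r where r: "i = Suc r" using assms by (cases i) auto
  have "pc 1 (of_nat ((2 * p - 1) choose (p + r)) - of_nat ((2 * p - 1) choose (p + Suc r))) ((-1) ^ r - (-1) ^ Suc r)"
    using assms r by (intro pc_diff c) auto
  then show ?thesis unfolding ballot_def r by simp
qed

definition ballot_sum :: "nat \<Rightarrow> int" where
  "ballot_sum i = (\<Sum>j\<in>{1..<p}. ballot j i)"

text \<open>Sum \<open>ballot_rec\<close> over \<open>j < p\<close>. Shifting \<open>j\<close> on
  the left adds \<open>ballot p i\<close> and loses \<open>ballot 1 i\<close>, which is zero because
  \<open>i >= 2\<close>.\<close>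

lemma ballot_sum_rec:
  assumes "i \<ge> 2"
  shows "ballot_sum (i + 1) + ballot_sum i + ballot_sum (i - 1) = ballot p i"
proof -
  have "(\<Sum>j\<in>{1..<p}. ballot (Suc j) i) = (\<Sum>j\<in>{1..<p}. ballot j (i + 1) + 2 * ballot j i + ballot j (i - 1))"
    using assms by (intro sum.cong) (auto simp: ballot_rec)
  also have "\<dots> = ballot_sum (i + 1) + 2 * ballot_sum i + ballot_sum (i - 1)"
    by (simp add: ballot_sum_def sum.distrib sum_distrib_left)
  finally have 1: "(\<Sum>j\<in>{1..<p}. ballot (Suc j) i) = \<dots>" .
  have "(\<Sum>j\<in>{1..<p}. ballot (Suc j) i) = (\<Sum>j\<in>{2..<Suc p}. ballot j i)"
    by (rule sum.reindex_bij_witness[of _ "\<lambda>j. j - 1" Suc]) auto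
  also have "\<dots> = (\<Sum>j\<in>{1..<Suc p}. ballot j i)"
    using assms by (intro sum.mono_neutral_left) (auto intro!: ballot_gt)
  also have "\<dots> = ballot_sum i + ballot p i"
    using p_pos by (simp add: ballot_sum_def)
  finally show ?thesis using 1 by simp
qed

text \<open>With \<open>i = p - r\<close>, the values \<open>u r = (-1)^i * ballot_sum i\<close>
  satisfy \<open>u (r + 2) = u (r + 1) - u r + 2\<close> modulo \<open>p\<close>, starting from
  \<open>0\<close> and \<open>1\<close>. The constant \<open>2\<close> is a particular solution and
  \<open>cos6\<close> solves the homogeneous recurrence.\<close>

lemma ballot_sum_cong:
  "r < p \<Longrightarrow> pc 1 (of_int (ballot_sum (p - r))) ((-1) ^ (p - r) * (2 - of_int (cos6 r)))"
proof (induction r rule: induct_nat_012)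
  case 0
  have "ballot_sum p = 0" unfolding ballot_sum_def by (intro sum.neutral) (auto intro!: ballot_gt)
  then show ?case by simp
next
  case 1
  have "ballot_sum (p - 1) = (\<Sum>j\<in>{p - 1}. ballot j (p - 1))"
    unfolding ballot_sum_def using p_gt_1 by (intro sum.mono_neutral_right) (auto intro!: ballot_gt)
  also have "\<dots> = 1" using p_gt_1 by (simp add: ballot_self)
  finally show ?case using odd_p by simp
next
  case (ge2 r)
  define i where "i = p - Suc r"
  have i: "2 \<le> i" "i < p" "p - r = i + 1" "p - Suc (Suc r) = i - 1" using ge2.prems by (auto simp: i_def)
  have "ballot_sum (i - 1) = ballot p i - ballot_sum i - ballot_sum (i + 1)"
    using ballot_sum_rec[OF i(1)] by simp
  then have "of_int (ballot_sum (i - 1)) = (of_int (ballot p i) - of_int (ballot_sum i) - of_int (ballot_sum (i + 1)) :: rat)"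
    by simp
  also have "pc 1 \<dots> (- 2 * (-1) ^ i - (-1) ^ i * (2 - of_int (cos6 (Suc r))) - (-1) ^ (i + 1) * (2 - of_int (cos6 r)))"
    using ge2 i by (intro pc_diff ballot_p) (auto simp: i_def)
  also have "\<dots> = (-1) ^ (i - 1) * (2 - of_int (cos6 (Suc (Suc r))))"
    using i by (cases i) (auto simp: algebra_simps)
  finally show ?case unfolding i .
qed

definition delta :: rat where
  "delta = (\<Sum>k\<in>{1..<p}. P * tcb k * esym 2 k)"

text \<open>The ballot number absorbs a factor \<open>i / j\<close>, which turns
  \<open>1 / i^4\<close> into \<open>1 / i^5\<close> and leaves it as the only place where
  \<open>j\<close> occurs. As it vanishes for \<open>i > j\<close>, the range of \<open>i\<close>
  can be made independent of \<open>j\<close>, ready for exchanging sums.\<close>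

lemma choose_hsym_2:
  assumes "0 < j" "j < p"
  shows "- (of_nat ((2 * j) choose j) / (2 * of_nat j)) * hsym 2 j = (\<Sum>i\<in>{1..<p}. (-1) ^ i * of_int (ballot j i) / of_nat i ^ 5)"
proof -
  have "hsym 2 j = 2 * (\<Sum>i=1..j. (-1) ^ (i - 1) * binom_ratio j i / of_nat i ^ 4)"
    using hsym_binom_ratio[OF assms(1), of 2] by simp
  then have "- (of_nat ((2 * j) choose j) / (2 * of_nat j)) * hsym 2 j
    = (\<Sum>i=1..j. - (of_nat ((2 * j) choose j) / of_nat j) * ((-1) ^ (i - 1) * binom_ratio j i / of_nat i ^ 4))"
    by (simp add: sum_distrib_left)
  also have "\<dots> = (\<Sum>i=1..j. (-1) ^ i * of_int (ballot j i) / of_nat i ^ 5)"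
  proof (intro sum.cong refl)
    fix i assume "i \<in> {1..j}"
    then obtain a where a: "i = Suc a" by (cases i) auto
    have "of_nat i ^ 5 = (of_nat i * of_nat i ^ 4 :: rat)" by (simp add: power_numeral_reduce)
    moreover have "of_int (ballot j i) = (of_nat i / of_nat j * of_nat ((2 * j) choose (j + i)) :: rat)"
      by (rule ballot_eq[OF assms(1)])
    moreover have "of_nat ((2 * j) choose j) \<noteq> (0::rat)" by simp
    moreover have "of_nat i \<noteq> (0::rat)" using a by simp
    ultimately show "- (of_nat ((2 * j) choose j) / of_nat j) * ((-1) ^ (i - 1) * binom_ratio j i / of_nat i ^ 4)
      = (-1) ^ i * of_int (ballot j i) / of_nat i ^ 5"
      by (simp add: binom_ratio_def) (simp add: a)
  qed
  also have "\<dots> = (\<Sum>i\<in>{1..<p}. (-1) ^ i * of_int (ballot j i) / of_nat i ^ 5)"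
    using assms by (intro sum.mono_neutral_left) (auto simp: ballot_gt)
  finally show ?thesis .
qed

text \<open>After reflection and exchange of sums, the sum over \<open>j\<close> is
  \<open>ballot_sum i\<close>. Its constant part gives \<open>2 * hpow 5\<close>, which vanishes
  modulo \<open>p\<close>; the minus signs from \<open>2 - cos6\<close> and from reflecting the
  fifth power cancel.\<close>

lemma delta_cong: "pc 1 delta (5 / 54 * B)"
proof -
  have "delta = (\<Sum>j\<in>{1..<p}. P * tcb (p - j) * esym 2 (p - j))"
    unfolding delta_def by (rule reflect_sum[symmetric])
  also have "pc 1 \<dots> (\<Sum>j\<in>{1..<p}. - (of_nat ((2 * j) choose j) / (2 * of_nat j)) * hsym 2 j)"
    by (intro pc_sum pc_mult tcb_reflect esym_2_reflect Zp_hsym) auto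
  also have "\<dots> = (\<Sum>j\<in>{1..<p}. \<Sum>i\<in>{1..<p}. (-1) ^ i * of_int (ballot j i) / of_nat i ^ 5)"
    by (intro sum.cong choose_hsym_2) auto
  also have "\<dots> = (\<Sum>i\<in>{1..<p}. (-1) ^ i / of_nat i ^ 5 * of_int (ballot_sum i))"
    by (subst sum.swap) (simp add: ballot_sum_def sum_distrib_left)
  also have "pc 1 \<dots> (\<Sum>i\<in>{1..<p}. (-1) ^ i / of_nat i ^ 5 * ((-1) ^ i * (2 - of_int (cos6 (p - i)))))"
  proof (intro pc_sum pc_mult_left)
    fix i assume i: "i \<in> {1..<p}"
    then show "pc 1 (of_int (ballot_sum i)) ((-1) ^ i * (2 - of_int (cos6 (p - i))))"
      using ballot_sum_cong[of "p - i"] by simp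
    show "(-1) ^ i / of_nat i ^ 5 \<in> Zp" using i by (intro Zp_divide_power_less Zp_power Zp_minus) auto
  qed
  also have "\<dots> = (\<Sum>i\<in>{1..<p}. 2 * (1 / of_nat i ^ 5) - of_int (cos6 (p - i)) * (1 / of_nat i ^ 5))"
  proof (intro sum.cong refl)
    fix i :: nat
    have "(-1) ^ i * (-1) ^ i = (1::rat)" by (simp flip: power_add mult_2)
    then have "(-1) ^ i / x * ((-1) ^ i * y) = y / x" for x y :: rat by (simp add: field_simps)
    then show "(-1) ^ i / of_nat i ^ 5 * ((-1) ^ i * (2 - of_int (cos6 (p - i)))) =
      2 * (1 / of_nat i ^ 5) - of_int (cos6 (p - i)) * (1 / of_nat i ^ 5 :: rat)"
      by (simp add: diff_divide_distrib)
  qed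
  also have "\<dots> = 2 * hpow 5 - (\<Sum>i\<in>{1..<p}. of_int (cos6 (p - i)) * (1 / of_nat i ^ 5))"
    unfolding hpow_def sum_distrib_left sum_subtractf ..
  also have "(\<Sum>i\<in>{1..<p}. of_int (cos6 (p - i)) * (1 / of_nat i ^ 5) :: rat) = (\<Sum>i\<in>{1..<p}. of_int (cos6 i) * (1 / of_nat (p - i) ^ 5))"
    unfolding reflect_sum[of "\<lambda>i. of_int (cos6 i) * (1 / of_nat (p - i) ^ 5)", symmetric]
    by (intro sum.cong) auto
  also have "pc 1 (2 * hpow 5 - \<dots>) (2 * 0 - (\<Sum>i\<in>{1..<p}. of_int (cos6 i) * ((-1) ^ 5 / of_nat i ^ 5)))"
    using p_gt_5 six_lt_p by (intro pc_diff pc_mult_left hpow_zero pc_sum reflect_inverse_power Zp_numeral Zp_of_int) auto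
  also have "\<dots> = (\<Sum>i\<in>{1..<p}. of_int (cos6 i) / of_nat i ^ 5)"
    by (simp add: sum_negf)
  also have "pc 1 \<dots> (5 / 54 * B)" by (rule cos6_sum[OF p_gt_5])
  finally show ?thesis .
qed

text \<open>Newton's identity \<open>esym_2\<close> reduces twice the sum to \<open>E - D4\<close>.
  \<open>E\<close> contains a square, but reflection gives \<open>E = - E - 2 * D2\<close> modulo
  \<open>p\<close>, and \<open>D2\<close>, \<open>D4\<close> are double sums of weight five with
  values \<open>-2 * B\<close> and \<open>-B\<close>.\<close>

lemma sum_esym_2_cong: "pc 1 (\<Sum>k\<in>{1..<p}. esym 2 k / of_nat k) (3 / 2 * B)"
proof -
  define D2 D4 E where "D2 = (\<Sum>k\<in>{1..<p}. esym 1 k / of_nat k ^ 3)"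
    and "D4 = (\<Sum>k\<in>{1..<p}. (\<Sum>m\<in>{1..<k}. 1 / of_nat m ^ 4) / of_nat k :: rat)"
    and "E = (\<Sum>k\<in>{1..<p}. esym 1 k ^ 2 / of_nat k)"
  \<comment> \<open>The quotient equals \<open>(p - 3) * (p - 4) / 6\<close>.\<close>
  have i2: "pc 1 (of_nat ((p - 2) choose 3) / of_nat (p - 2)) 2"
  proof -
    have "of_nat (p - 2) = P - 2" "of_nat (p - 2) - 2 = P - 4" "of_nat (p - 2) - 1 = P - 3" using p_gt_5 by (auto simp: of_nat_diff)
    then have "of_nat ((p - 2) choose 3) = (P - 2) * (P - 3) * (P - 4) / 6"
      by (simp add: binomial_gbinomial gbinomial_prod_rev numeral_eq_Suc fact_numeral)
    moreover have "P - 2 \<noteq> 0" 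
      unfolding \<open>of_nat (p - 2) = P - 2\<close>[symmetric] of_nat_eq_0_iff using p_gt_5 by auto
    ultimately have "of_nat ((p - 2) choose 3) / of_nat (p - 2) = (P - 3) * (P - 4) / 6"
      unfolding \<open>of_nat (p - 2) = P - 2\<close> by simp
    then have e: "of_nat ((p - 2) choose 3) / of_nat (p - 2) - 2 = P ^ 1 * ((P - 7) / of_nat 6)"
      by (simp add: field_simps)
    have "(P - 7) / of_nat 6 \<in> Zp" using six_lt_p by (intro Zp_divide_less Zp_diff) auto
    then show ?thesis using e by (rule pcI)
  qed
  have "D2 = (\<Sum>j\<in>{1..<p}. (\<Sum>i\<in>{1..<j}. 1 / of_nat i ^ 2) / of_nat j ^ (5 - 2))"
    unfolding D2_def by simp
  also have "pc 1 \<dots> (- (of_nat ((p - 2) choose (5 - 2)) / of_nat (p - 2) * B))"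
    using p_gt_5 by (intro double_power_sum) auto
  also have "pc 1 \<dots> (- (2 * B))"
    using i2 by (intro pc_minus pc_mult_right Zp_B) simp
  finally have D2: "pc 1 D2 (- (2 * B))" .
  have "D4 = (\<Sum>j\<in>{1..<p}. (\<Sum>i\<in>{1..<j}. 1 / of_nat i ^ 4) / of_nat j ^ (5 - 4))"
    unfolding D4_def by simp
  also have "pc 1 \<dots> (- (of_nat ((p - 4) choose (5 - 4)) / of_nat (p - 4) * B))"
    using p_gt_5 by (intro double_power_sum) auto
  also have "- (of_nat ((p - 4) choose (5 - 4)) / of_nat (p - 4) * B) = - B"
    using p_gt_5 by simp
  finally have D4: "pc 1 D4 (- B)" .
  have "E = (\<Sum>k\<in>{1..<p}. esym 1 (p - k) ^ 2 / of_nat (p - k))"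
    unfolding E_def by (rule reflect_sum[symmetric])
  also have "\<dots> = (\<Sum>k\<in>{1..<p}. esym 1 (p - k) ^ 2 * (1 / of_nat (p - k) ^ 1))" by simp
  also have "pc 1 \<dots> (\<Sum>k\<in>{1..<p}. (- hsym 1 k) ^ 2 * ((-1) ^ 1 / of_nat k ^ 1))"
    by (intro pc_sum pc_mult pc_power esym_1_reflect reflect_inverse_power Zp_power Zp_esym Zp_minus Zp_hsym Zp_divide_power_less Zp_1) auto
  also have "\<dots> = - E - 2 * D2 - hpow 5"
    unfolding E_def D2_def hpow_def sum_distrib_left sum_negf[symmetric] sum_subtractf[symmetric]
  proof (intro sum.cong refl)
    fix k assume k: "k \<in> {1..<p}"
    define x where "x = (of_nat k :: rat)"
    have x: "x \<noteq> 0" using k by (simp add: x_def)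
    have "hsym 1 k = (\<Sum>l\<in>{1..<Suc k}. 1 / of_nat l ^ 2)" by (simp add: atLeastLessThanSuc_atLeastAtMost)
    also have "\<dots> = esym 1 k + 1 / x ^ 2" using k by (simp add: x_def)
    finally have h: "hsym 1 k = esym 1 k + 1 / x ^ 2" .
    have "(- (e + 1 / x ^ 2)) ^ 2 * ((-1) ^ 1 / x ^ 1) = - (e ^ 2 / x) - 2 * (e / x ^ 3) - 1 / x ^ 5" for e
      using x by (simp add: field_simps power_numeral_reduce)
    then show "(- hsym 1 k) ^ 2 * ((-1) ^ 1 / of_nat k ^ 1) = - (esym 1 k ^ 2 / of_nat k) - 2 * (esym 1 k / of_nat k ^ 3) - 1 / of_nat k ^ 5"
      unfolding h x_def .
  qed
  finally have "pc 1 (E + E) (E + (- E - 2 * D2 - hpow 5))" by (intro pc_add pc_refl)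
  also have "E + (- E - 2 * D2 - hpow 5) = - 2 * D2 - hpow 5" by simp
  also have "pc 1 \<dots> (- 2 * D2 - 0)" using six_lt_p by (intro pc_diff pc_refl hpow_zero) auto
  finally have "pc 1 (2 * E) (2 * (- D2))" by simp
  then have E: "pc 1 E (- D2)" by (rule pc_cancel) (auto intro: Zp_half)
  have "2 * (\<Sum>k\<in>{1..<p}. esym 2 k / of_nat k) = E - D4"
    unfolding E_def D4_def sum_distrib_left sum_subtractf[symmetric]
  proof (intro sum.cong refl)
    fix k
    show "2 * (esym 2 k / of_nat k) = esym 1 k ^ 2 / of_nat k - (\<Sum>m\<in>{1..<k}. 1 / of_nat m ^ 4) / of_nat k"
      unfolding diff_divide_distrib[symmetric] esym_2[symmetric] by simp
  qed
  also have "pc 1 \<dots> (- (- (2 * B)) - (- B))"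
    by (intro pc_diff D4 pc_trans[OF E] pc_minus D2)
  finally have "pc 1 (2 * (\<Sum>k\<in>{1..<p}. esym 2 k / of_nat k)) (2 * (3 / 2 * B))" by simp
  then show ?thesis by (rule pc_cancel) (auto intro: Zp_half)
qed

section \<open>The correction term \<open>kappa\<close>\<close>

definition kappa :: rat where
  "kappa = (\<Sum>k\<in>{1..<p}. P * tcb k * (1 / of_nat k ^ 4 - esym 1 k / of_nat k ^ 2))"

text \<open>\<open>P\<close> times \<open>apery_sum_esym2\<close> at \<open>n = p - 1\<close>: the
  weights become \<open>1 / k\<close>, and the alternating sum of \<open>1 / k^6\<close> drops out,
  being integral and multiplied by \<open>p\<close>.\<close>

lemma kappa_delta: "pc 1 (4 * kappa + 3 * delta) (- (\<Sum>k\<in>{1..<p}. esym 2 k / of_nat k))"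
proof -
  have I: "{1..p - 1} = {1..<p}" using p_pos by auto
  define Z where "Z = (\<Sum>k\<in>{1..<p}. 2 * (-1) ^ (k - 1) / of_nat k ^ 6 :: rat)"
  have Z: "Z \<in> Zp" unfolding Z_def by (intro Zp_sum Zp_divide_power_less Zp_mult Zp_power Zp_minus) auto
  have "P * apery_sum (esym 2) (p - 1) = (\<Sum>k\<in>{1..<p}. P * ((-1) ^ (p - 1 + k) * apery_weight (p - 1) k) * esym 2 k)"
    unfolding apery_sum_def I sum_distrib_left by (simp add: mult.assoc)
  also have "pc 1 \<dots> (\<Sum>k\<in>{1..<p}. 1 / of_nat k * esym 2 k)"
    by (intro pc_sum pc_mult_right apery_weight_cong Zp_esym) auto
  finally have 1: "pc 1 (P * apery_sum (esym 2) (p - 1)) (\<Sum>k\<in>{1..<p}. esym 2 k / of_nat k)" by simp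
  have "P * apery_sum (esym 2) (p - 1) = - (4 * kappa + 3 * delta) + P * Z"
    unfolding apery_sum_esym2 I kappa_def delta_def Z_def sum_distrib_left sum.distrib[symmetric] sum_negf[symmetric]
    by (intro sum.cong refl) (simp add: algebra_simps)
  also have "pc 1 \<dots> (- (4 * kappa + 3 * delta) + 0)"
    by (intro pc_add pc_refl pc_multiple_1 Z)
  finally have "pc 1 (P * apery_sum (esym 2) (p - 1)) (- (4 * kappa + 3 * delta))" by simp
  from pc_minus[OF pc_euclidean[OF this 1]] show ?thesis by (simp only: minus_minus)
qed

lemma kappa_cong: "pc 1 kappa (- 4 / 9 * B)"
proof -
  have "4 * kappa = 4 * kappa + 3 * delta - 3 * delta" by simp
  also have "pc 1 \<dots> (- (3 / 2 * B) - 3 * (5 / 54 * B))"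
    by (intro pc_diff pc_mult_left delta_cong Zp_numeral pc_trans[OF kappa_delta] pc_minus sum_esym_2_cong)
  also have "\<dots> = 4 * (- 4 / 9 * B)" by simp
  finally have "pc 1 (4 * kappa) (4 * (- 4 / 9 * B))" .
  then show ?thesis
    by (rule pc_cancel) (use p_gt_5 in \<open>auto intro: Zp_inverse_numeral\<close>)
qed

text \<open>Reflection together with
  \<open>1 / (p - j)^3 = - 1 / j^3 - 3 p / j^4 - 6 p^2 / j^5\<close> modulo \<open>p^3\<close>; the
  last term sums to zero, since \<open>hpow 5\<close> vanishes modulo \<open>p\<close>.\<close>

lemma hpow3_cong: "pc 3 (hpow 3) (- 3 / 2 * (P * hpow 4))"
proof -
  have "pc 3 (\<Sum>j\<in>{1..<p}. 1 / of_nat j ^ 3 + 1 / of_nat (p - j) ^ 3 + 3 * P / of_nat j ^ 4 + 6 * P ^ 2 / of_nat j ^ 5) (\<Sum>j\<in>{1..<p}. 0)"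
  proof (intro pc_sum)
    fix j assume j: "j \<in> {1..<p}"
    define x y where "x = (of_nat j :: rat)" and "y = (of_nat (p - j) :: rat)"
    have y: "y = P - x" "x \<noteq> 0" "y \<noteq> 0" using j by (auto simp: x_def y_def of_nat_diff simp flip: of_nat_diff)
    have e: "1 / x ^ 3 + 1 / y ^ 3 + 3 * P / x ^ 4 + 6 * P ^ 2 / x ^ 5 - 0 = P ^ 3 * ((10 * x ^ 2 - 15 * P * x + 6 * P ^ 2) / y ^ 3 / x ^ 5)"
      using y(2,3) by (simp add: divide_simps) (simp add: y(1) algebra_simps power_numeral_reduce)
    have "(10 * x ^ 2 - 15 * P * x + 6 * P ^ 2) / y ^ 3 / x ^ 5 \<in> Zp"
      unfolding x_def y_def using j
      by (intro Zp_divide_power_less Zp_add Zp_diff Zp_mult Zp_power Zp_of_nat Zp_numeral) auto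
    from pcI[OF this e] show "pc 3 (1 / of_nat j ^ 3 + 1 / of_nat (p - j) ^ 3 + 3 * P / of_nat j ^ 4 + 6 * P ^ 2 / of_nat j ^ 5) 0"
      unfolding x_def y_def .
  qed
  moreover have "(\<Sum>j\<in>{1..<p}. 1 / of_nat j ^ 3 + 1 / of_nat (p - j) ^ 3 + 3 * P / of_nat j ^ 4 + 6 * P ^ 2 / of_nat j ^ 5)
     = 2 * hpow 3 + 3 * (P * hpow 4) + 6 * (P ^ 2 * hpow 5)"
  proof -
    have "(\<Sum>j\<in>{1..<p}. 1 / of_nat (p - j) ^ 3) = hpow 3"
      unfolding hpow_def by (rule reflect_sum)
    then show ?thesis unfolding sum.distrib by (simp add: hpow_def sum_distrib_left)
  qed
  ultimately have 1: "pc 3 (2 * hpow 3 + 3 * (P * hpow 4) + 6 * (P ^ 2 * hpow 5)) 0" by simp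
  have "pc 1 (hpow 5) 0" using six_lt_p by (intro hpow_zero) auto
  from pc_scale[OF this, of 2] have "pc 3 (P ^ 2 * hpow 5) 0" by simp
  then have "pc 3 (6 * (P ^ 2 * hpow 5)) 0" using pc_mult_left[of 6 3 "P ^ 2 * hpow 5" 0] by simp
  from pc_diff[OF 1 this] have "pc 3 (2 * hpow 3 + 3 * (P * hpow 4)) 0" by simp
  from pc_diff[OF this pc_refl[of 3 "3 * (P * hpow 4)"]]
  have "pc 3 (2 * hpow 3) (2 * (- 3 / 2 * (P * hpow 4)))" by simp
  then show ?thesis by (rule pc_cancel) (auto intro: Zp_half)
qed

definition pole_sum :: rat where
  "pole_sum = (\<Sum>k\<in>{1..<p}. 1 / (of_nat k * (of_nat k ^ 2 - P ^ 2)))"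

text \<open>The modulus is \<open>p^3\<close> because \<open>pole_sum\<close> gets divided by
  \<open>2 * P\<close>. Each summand is \<open>1 / k^3\<close> plus \<open>p^2\<close> times a
  quantity congruent to \<open>1 / k^5\<close>, whose sum vanishes modulo \<open>p\<close>.\<close>

lemma pole_sum_cong: "pc 3 pole_sum (- 6 / 5 * (P ^ 2 * B))"
proof -
  define Q where "Q = (\<Sum>k\<in>{1..<p}. 1 / (of_nat k ^ 2 - P ^ 2) / of_nat k ^ 3)"
  have "pc 1 Q (hpow 5)"
    unfolding Q_def hpow_def
  proof (intro pc_sum)
    fix k assume k: "k \<in> {1..<p}"
    define x where "x = (of_nat k :: rat)"
    have x: "x \<noteq> 0" "x ^ 2 - P ^ 2 \<noteq> 0" "1 / (x ^ 2 - P ^ 2) \<in> Zp"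
      using k Zp_inverse_square_minus[of k] by (auto simp: x_def)
    have e: "1 / (x ^ 2 - P ^ 2) / x ^ 3 - 1 / x ^ 5 = P ^ 1 * (P * (1 / (x ^ 2 - P ^ 2)) / x ^ 5)"
      using x(1,2) by (simp add: divide_simps) (simp add: algebra_simps power_numeral_reduce)
    have "P * (1 / (x ^ 2 - P ^ 2)) / x ^ 5 \<in> Zp"
      unfolding x_def using k x by (intro Zp_divide_power_less Zp_mult Zp_of_nat) (auto simp: x_def)
    from pcI[OF this e] show "pc 1 (1 / (of_nat k ^ 2 - P ^ 2) / of_nat k ^ 3) (1 / of_nat k ^ 5)"
      unfolding x_def .
  qed
  also have "pc 1 \<dots> 0" using six_lt_p by (intro hpow_zero) auto
  finally have "pc 1 Q 0" .
  from pc_scale[OF this, of 2] have Q: "pc 3 (P ^ 2 * Q) 0" by simp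
  have "pole_sum = hpow 3 + P ^ 2 * Q"
    unfolding pole_sum_def hpow_def Q_def sum_distrib_left sum.distrib[symmetric]
  proof (intro sum.cong refl)
    fix k assume k: "k \<in> {1..<p}"
    define x where "x = (of_nat k :: rat)"
    have x: "x \<noteq> 0" "x ^ 2 - P ^ 2 \<noteq> 0"
      using k Zp_inverse_square_minus[of k] by (auto simp: x_def)
    have "1 / (x * (x ^ 2 - P ^ 2)) = 1 / x ^ 3 + P ^ 2 * (1 / (x ^ 2 - P ^ 2) / x ^ 3)"
      using x by (simp add: divide_simps) (simp add: algebra_simps power_numeral_reduce)
    then show "1 / (of_nat k * (of_nat k ^ 2 - P ^ 2)) = 1 / of_nat k ^ 3 + P ^ 2 * (1 / (of_nat k ^ 2 - P ^ 2) / of_nat k ^ 3)"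
      unfolding x_def .
  qed
  also have "pc 3 \<dots> (- 3 / 2 * (P * hpow 4) + 0)"
    by (intro pc_add hpow3_cong Q)
  also have "pc 3 (- 3 / 2 * (P * hpow 4) + 0) (- 3 / 2 * (P * (4 / 5 * P * B)) + 0)"
  proof (rule pc_add[OF pc_mult_left pc_refl])
    show "- 3 / 2 \<in> Zp" using Zp_mult[OF Zp_minus[OF Zp_numeral[of "num.Bit1 num.One"]] Zp_half] by simp
    show "pc 3 (P * hpow 4) (P * (4 / 5 * P * B))"
      using pc_scale[OF hpow4_cong[OF p_gt_5], of 1] by (simp add: numeral_3_eq_3 numeral_2_eq_2)
  qed
  finally show ?thesis by (simp add: power2_eq_square mult_ac)
qed

text \<open>\<open>vprod\<close> and \<open>1 / (k^2 - p^2)\<close> are expanded exactly, with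
  remainder divisible by \<open>p^4\<close>; one of these factors \<open>p\<close> makes
  \<open>tcb k\<close> integral and enough remain for the modulus. The terms of order
  \<open>p^2\<close> add up to \<open>P * kappa\<close>.\<close>

lemma main_expansion:
  "pc 2 (\<Sum>k\<in>{1..<p}. tcb k * vprod (P ^ 2) k / (of_nat k ^ 2 - P ^ 2)) ((\<Sum>k\<in>{1..<p}. tcb k / of_nat k ^ 2) + P * kappa)"
proof -
  have "pc 2 (\<Sum>k\<in>{1..<p}. tcb k * vprod (P ^ 2) k / (of_nat k ^ 2 - P ^ 2))
     (\<Sum>k\<in>{1..<p}. tcb k / of_nat k ^ 2 + P * (P * tcb k * (1 / of_nat k ^ 4 - esym 1 k / of_nat k ^ 2)))"
  proof (intro pc_sum)
    fix k assume k: "k \<in> {1..<p}"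
    obtain z where z: "z \<in> Zp" "vprod (P ^ 2) k = 1 - P ^ 2 * esym 1 k + P ^ 4 * z"
      using vprod_expansion[of k] k by auto
    define x e where "x = (of_nat k :: rat)" and "e = esym 1 k"
    define i where "i = 1 / (x ^ 2 - P ^ 2)"
    have x: "x \<noteq> 0" "x ^ 2 - P ^ 2 \<noteq> 0" and i: "i \<in> Zp"
      using k Zp_inverse_square_minus[of k] by (auto simp: x_def i_def)
    \<comment> \<open>The geometric series in closed form, to be substituted into itself until the
      error has order \<open>p^4\<close>.\<close>
    have ie: "i = 1 / x ^ 2 + P ^ 2 * (i / x ^ 2)"
      using x unfolding i_def by (simp add: divide_simps)
    have *: "(1 - P ^ 2 * e + P ^ 4 * z) * i = 1 / x ^ 2 + P ^ 2 * (1 / x ^ 4 - e / x ^ 2) + P ^ 4 * (i / x ^ 4 - e * i / x ^ 2 + z * i)"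
    proof -
      have *: "(1 - P ^ 2 * e + P ^ 4 * z) * i = i - P ^ 2 * e * i + P ^ 4 * (z * i)" by (simp add: algebra_simps)
      also have "i - P ^ 2 * e * i = 1 / x ^ 2 + P ^ 2 * ((1 / x ^ 2 + P ^ 2 * (i / x ^ 2)) / x ^ 2) - P ^ 2 * e * (1 / x ^ 2 + P ^ 2 * (i / x ^ 2))"
        using ie by metis
      finally show ?thesis by (simp add: algebra_simps add_divide_distrib flip: power_add)
    qed
    have "tcb k * vprod (P ^ 2) k / (x ^ 2 - P ^ 2) - (tcb k / x ^ 2 + P * (P * tcb k * (1 / x ^ 4 - e / x ^ 2)))
      = P ^ 2 * (P * (P * tcb k) * (i / x ^ 4 - e * i / x ^ 2 + z * i))"
    proof -
      have "tcb k * vprod (P ^ 2) k / (x ^ 2 - P ^ 2) = tcb k * ((1 - P ^ 2 * e + P ^ 4 * z) * i)"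
        unfolding z(2) i_def e_def by simp
      then show ?thesis unfolding * by (simp add: algebra_simps power_numeral_reduce)
    qed
    moreover have "P * (P * tcb k) * (i / x ^ 4 - e * i / x ^ 2 + z * i) \<in> Zp"
      unfolding x_def e_def using k z i
      by (intro Zp_mult Zp_add Zp_diff Zp_divide_power_less Zp_of_nat Zp_P_tcb Zp_esym) auto
    ultimately show "pc 2 (tcb k * vprod (P ^ 2) k / (of_nat k ^ 2 - P ^ 2))
      (tcb k / of_nat k ^ 2 + P * (P * tcb k * (1 / of_nat k ^ 4 - esym 1 k / of_nat k ^ 2)))"
      unfolding x_def e_def by (rule pcI[rotated])
  qed
  then show ?thesis by (simp add: sum.distrib kappa_def sum_distrib_left)
qed

lemma tcb_sum_cong:
  "pc 2 (\<Sum>k\<in>{1..<p}. tcb k / of_nat k ^ 2) ((\<Sum>k\<in>{1..<p}. 1 / of_nat k) / P ^ 3 - 7 / 45 * P * B)"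
proof -
  define h where "h = (\<Sum>k\<in>{1..<p}. 1 / of_nat k :: rat)"
  have "P * (pole_sum / (2 * P)) = 1 / 2 * pole_sum" using p_pos by simp
  also have "pc 3 \<dots> (1 / 2 * (- 6 / 5 * (P ^ 2 * B)))"
    by (intro pc_mult_left pole_sum_cong Zp_half)
  also have "\<dots> = P * (- 3 / 5 * (P * B))" by (simp add: power2_eq_square)
  finally have 1: "pc 2 (pole_sum / (2 * P)) (- 3 / 5 * (P * B))" by (rule pc_unscale_2)
  have 2: "pc 2 (P * kappa) (P * (- 4 / 9 * B))" by (intro pc_scale_1 kappa_cong)
  have "h / P ^ 3 + pole_sum / (2 * P) = (\<Sum>k\<in>{1..<p}. tcb k * vprod (P ^ 2) k / (of_nat k ^ 2 - P ^ 2))"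
    unfolding sum_tcb_vprod_pole[OF odd_p cos6_p] h_def pole_sum_def ..
  also have "pc 2 \<dots> ((\<Sum>k\<in>{1..<p}. tcb k / of_nat k ^ 2) + P * kappa)" by (rule main_expansion)
  finally have "pc 2 (h / P ^ 3 + pole_sum / (2 * P) - P * kappa) ((\<Sum>k\<in>{1..<p}. tcb k / of_nat k ^ 2) + P * kappa - P * kappa)"
    by (intro pc_diff pc_refl)
  then have 3: "pc 2 (h / P ^ 3 + pole_sum / (2 * P) - P * kappa) (\<Sum>k\<in>{1..<p}. tcb k / of_nat k ^ 2)" by simp
  have "pc 2 (h / P ^ 3 + pole_sum / (2 * P) - P * kappa) (h / P ^ 3 + - 3 / 5 * (P * B) - P * (- 4 / 9 * B))"
    by (intro pc_diff pc_add pc_refl 1 2)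
  from pc_euclidean[OF 3 this] show ?thesis by (simp add: h_def mult.assoc)
qed

end

theorem theorem1:
  fixes p :: nat
  assumes "prime p" and "p > 5"
  shows "padic_cong p 2
    (\<Sum>k=1..p-1. 1 / (of_nat k ^ 4 * of_nat ((2 * k) choose k)))
    (harmonic (p - 1) / of_nat p ^ 3 - 7 / 45 * of_nat p * bernoulli (p - 5))"
proof -
  interpret prime_gt_5 p
    using assms by unfold_locales
  have I: "{1..p - 1} = {1..<p}" using p_pos by auto
  have "(\<Sum>k\<in>{1..<p}. tcb k / of_nat k ^ 2) = (\<Sum>k=1..p-1. 1 / (of_nat k ^ 4 * of_nat ((2 * k) choose k)))"
    unfolding I tcb_def by (simp add: mult_ac flip: power_add)
  then show ?thesis using tcb_sum_cong unfolding harmonic_def I by simp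
qed

end
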